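(* Let $q\equiv 1\pmod 4$, $q\not\equiv 1 \pmod 3$, and let $G$, $\bm{p}$, $\pi$ be as in the context, with $G$ viewed as a collineation group of $\mathrm{PG}(3,q)$ via the Klein correspondence. The orbits of $G$ on the points of $\mathrm{PG}(3,q)$ are: (i) $\{\bm{p}\}$ ($\bm{p}$ is fixed); (ii) the set of points of $\pi$, forming a single orbit of size $q^2+q+1$; (iii) the remaining points, which fall into four orbits, each of size $\frac{q-1}{4}(q^2+q+1)$.
   Context: $\mathbb{F}=\mathbb{F}_q$, $\mathbb{E}=\mathbb{F}_{q^3}$, $\mathrm{T}(x)=x+x^q+x^{q^2}$. Fix a primitive element $\alpha$ of $\mathbb{E}$, put $\omega=\alpha^{q^2+q+1}$ and $\mu=\alpha^{q-1}$. On $V=\mathbb{E}^2$ (an $\mathbb{F}$-space of dimension 6) take the quadratic form $\mathrm{Q}((u,v))=\mathrm{T}(uv)$, whose quadric is a hyperbolic quadric $\mathcal{Q}^+(5,q)$ in $\mathrm{PG}(5,q)$, with disjoint generators $\pi_1=\{\langle(x,0)\rangle : x\in\mathbb{E}^*\}$ and $\pi_2=\{\langle(0,y)\rangle: y\in\mathbb{E}^*\}$. Let $G=\langle c,z\rangle$ where $c:(u,v)\mapsto(\mu u,\mu^{-1}v)$ and $z:(u,v)\mapsto(u,\omega^4v)$; these fix $\pi_1$ and $\pi_2$ and thus preserve each system of generators. Fix a Klein correspondence, i.e. a bijection from the points of the quadric to the lines of $\mathrm{PG}(3,q)$ such that points are collinear on the quadric iff the image lines meet, chosen so that $\pi_1$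 is mapped to the set of lines through a point $\bm{p}$ and $\pi_2$ to the set of lines in a plane $\pi$; via this correspondence $G$ acts as a collineation group of $\mathrm{PG}(3,q)$. *)

theory Defs
  imports "HOL-Analysis.Analysis" "HOL-Algebra.Group_Action" "HOL-Algebra.Generated_Groups"
begin

section \<open>Projective spaces and collineations\<close>

text \<open>A subspace of \<open>PG(V)\<close> is a linear subspace of \<open>V\<close>; here \<open>k\<close> is the vector space dimension,
  so points, lines and planes are the cases \<open>k = 1, 2, 3\<close>, and incidence is inclusion.\<close>

definition subspaces_of_dim ::
    "('k::field \<Rightarrow> 'v::ab_group_add \<Rightarrow> 'v) \<Rightarrow> nat \<Rightarrow> 'v set set" where
  "subspaces_of_dim sc k = {S. module.subspace sc S \<and> vector_space.dim sc S = k}"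

abbreviation pg3_points :: "('k::field ^ 4) set set" where
  "pg3_points \<equiv> subspaces_of_dim (*s) 1"

abbreviation pg3_lines :: "('k::field ^ 4) set set" where
  "pg3_lines \<equiv> subspaces_of_dim (*s) 2"

abbreviation pg3_planes :: "('k::field ^ 4) set set" where
  "pg3_planes \<equiv> subspaces_of_dim (*s) 3"

definition points_on :: "('k::field ^ 4) set \<Rightarrow> ('k ^ 4) set set" where
  "points_on S = {P \<in> pg3_points. P \<subseteq> S}"

definition lines_meet :: "('k::field ^ 4) set \<Rightarrow> ('k ^ 4) set \<Rightarrow> bool" where
  "lines_meet L M \<longleftrightarrow> points_on L \<inter> points_on M \<noteq> {}"

text \<open>A collineation is a permutation of the points, \<open>undefined\<close> outside \<open>pg3_points\<close> by the
  convention of \<^const>\<open>Bij\<close>, which permutes the lines regarded as sets of points.\<close>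

definition collineations :: "(('k::field ^ 4) set \<Rightarrow> ('k ^ 4) set) set" where
  "collineations = {f \<in> Bij pg3_points.
     bij_betw (image f) (points_on ` pg3_lines) (points_on ` pg3_lines)}"


section \<open>The quadric on the \<open>F\<close>-space \<open>E\<^sup>2\<close>\<close>

text \<open>The inclusion of \<open>F\<close> in \<open>E\<close> is a ring homomorphism \<open>\<iota>\<close> from the type of elements of \<open>F\<close> to
  the type of elements of \<open>E\<close>.\<close>

definition field_embedding :: "('f::field \<Rightarrow> 'e::field) \<Rightarrow> bool" where
  "field_embedding \<iota> \<longleftrightarrow> \<iota> 1 = 1 \<and> (\<forall>a b. \<iota> (a + b) = \<iota> a + \<iota> b) \<and> (\<forall>a b. \<iota> (a * b) = \<iota> a * \<iota> b)"

definition scaleV :: "('f::field \<Rightarrow> 'e::field) \<Rightarrow> 'f \<Rightarrow> 'e \<times> 'e \<Rightarrow> 'e \<times> 'e" where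
  "scaleV \<iota> a w = (\<iota> a * fst w, \<iota> a * snd w)"

lemma vector_space_scaleV:
  assumes "field_embedding \<iota>"
  shows "vector_space (scaleV \<iota>)"
  using assms
  by (unfold_locales) (auto simp: scaleV_def field_embedding_def algebra_simps)

definition primitive_element :: "'e::field \<Rightarrow> bool" where
  "primitive_element \<alpha> \<longleftrightarrow> \<alpha> \<noteq> 0 \<and> (\<forall>x. x \<noteq> 0 \<longrightarrow> (\<exists>n::nat. x = \<alpha> ^ n))"

definition trace3 :: "nat \<Rightarrow> 'e::field \<Rightarrow> 'e" where
  "trace3 q x = x + x ^ q + x ^ (q ^ 2)"

definition Qform :: "nat \<Rightarrow> 'e::field \<times> 'e \<Rightarrow> 'e" where
  "Qform q w = trace3 q (fst w * snd w)"

definition quadric_points :: "nat \<Rightarrow> ('f::field \<Rightarrow> 'e::field) \<Rightarrow> ('e \<times> 'e) set set" where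
  "quadric_points q \<iota> = {x \<in> subspaces_of_dim (scaleV \<iota>) 1. \<forall>w\<in>x. Qform q w = 0}"

definition quadric_lines :: "nat \<Rightarrow> ('f::field \<Rightarrow> 'e::field) \<Rightarrow> ('e \<times> 'e) set set" where
  "quadric_lines q \<iota> = {l \<in> subspaces_of_dim (scaleV \<iota>) 2. \<forall>w\<in>l. Qform q w = 0}"

definition collinear_on_quadric ::
    "nat \<Rightarrow> ('f::field \<Rightarrow> 'e::field) \<Rightarrow> ('e \<times> 'e) set \<Rightarrow> ('e \<times> 'e) set \<Rightarrow> bool" where
  "collinear_on_quadric q \<iota> x y \<longleftrightarrow> (\<exists>l\<in>quadric_lines q \<iota>. x \<subseteq> l \<and> y \<subseteq> l)"

definition pi1 :: "('f::field \<Rightarrow> 'e::field) \<Rightarrow> ('e \<times> 'e) set set" where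
  "pi1 \<iota> = {module.span (scaleV \<iota>) {(x, 0)} | x. x \<noteq> 0}"

definition pi2 :: "('f::field \<Rightarrow> 'e::field) \<Rightarrow> ('e \<times> 'e) set set" where
  "pi2 \<iota> = {module.span (scaleV \<iota>) {(0, y)} | y. y \<noteq> 0}"


section \<open>The group\<close>

definition c_map :: "nat \<Rightarrow> 'e::field \<Rightarrow> 'e \<times> 'e \<Rightarrow> 'e \<times> 'e" where
  "c_map q \<alpha> = (\<lambda>(u, v). let \<mu> = \<alpha> ^ (q - 1) in (\<mu> * u, inverse \<mu> * v))"

definition z_map :: "nat \<Rightarrow> 'e::field \<Rightarrow> 'e \<times> 'e \<Rightarrow> 'e \<times> 'e" where
  "z_map q \<alpha> = (\<lambda>(u, v). let \<omega> = \<alpha> ^ (q ^ 2 + q + 1) in (u, \<omega> ^ 4 * v))"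

definition G_group :: "nat \<Rightarrow> 'e::field \<Rightarrow> ('e \<times> 'e \<Rightarrow> 'e \<times> 'e) monoid" where
  "G_group q \<alpha> =
     (BijGroup UNIV)\<lparr>carrier := generate (BijGroup UNIV) {c_map q \<alpha>, z_map q \<alpha>}\<rparr>"


section \<open>The Klein correspondence\<close>

definition klein_correspondence ::
    "nat \<Rightarrow> ('f::field \<Rightarrow> 'e::field) \<Rightarrow> (('e \<times> 'e) set \<Rightarrow> ('f ^ 4) set) \<Rightarrow> bool" where
  "klein_correspondence q \<iota> \<kappa> \<longleftrightarrow>
     bij_betw \<kappa> (quadric_points q \<iota>) pg3_lines \<and>
     (\<forall>x\<in>quadric_points q \<iota>. \<forall>y\<in>quadric_points q \<iota>.
        collinear_on_quadric q \<iota> x y \<longleftrightarrow> lines_meet (\<kappa> x) (\<kappa> y))"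

text \<open>The collineation of \<open>PG(3,q)\<close> induced by a map \<open>g\<close> on the quadric: the one that acts on the
  lines as \<open>g\<close> acts on the corresponding points of the quadric. It is unique because a point is
  determined by the lines through it, and it exists when \<open>g\<close> is a similarity of the quadratic form
  that preserves each system of generators, as all elements of the group do.\<close>

definition klein_action ::
    "nat \<Rightarrow> ('f::field \<Rightarrow> 'e::field) \<Rightarrow> (('e \<times> 'e) set \<Rightarrow> ('f ^ 4) set)
      \<Rightarrow> ('e \<times> 'e \<Rightarrow> 'e \<times> 'e) \<Rightarrow> ('f ^ 4) set \<Rightarrow> ('f ^ 4) set" where
  "klein_action q \<iota> \<kappa> g =
     (THE f. f \<in> collineations \<and>
        (\<forall>x\<in>quadric_points q \<iota>. f ` points_on (\<kappa> x) = points_on (\<kappa> (g ` x))))"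

end

theory Submission
  imports Defs
begin

text \<open>An element of \<open>G\<close> acts on the quadric as a diagonal similarity, so via the Klein correspondence it
  permutes the lines of \<open>PG(3,q)\<close>, preserving whether two lines meet and the star of \<open>p\<close>. Maximal cliques
  of meeting lines are stars and ruled planes, and a star differing from that of \<open>p\<close> has exactly one line
  in common with it, while a ruled plane has none or several; hence stars go to stars and the
  permutation comes from a unique collineation.

  Since \<open>q - 1\<close> and \<open>q\<^sup>2 + q + 1\<close> are coprime, the powers of \<open>\<mu>\<close> represent all classes of
  \<open>E\<^sup>* / F\<^sup>*\<close> once. So \<open>G\<close> is transitive on the lines through \<open>p\<close>, hence on the points of \<open>\<pi>\<close>, and an element
  fixing a further point \<open>P\<close> fixes the line \<open>pP\<close> and must have the form \<open>(u, v) \<mapsto> (u, t v)\<close>.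
  If \<open>t \<noteq> 1\<close> such a map fixes only \<open>p\<close> and the points of \<open>\<pi>\<close>. Thus \<open>G\<close>, of order
  \<open>(q - 1)/4 * (q\<^sup>2 + q + 1)\<close>, acts freely on the remaining \<open>(q - 1) * (q\<^sup>2 + q + 1)\<close> points.\<close>

section \<open>Points, lines and planes of \<open>PG(3,q)\<close>\<close>

context vector_space
begin

lemma subspaces_of_dim_1_iff:
  "S \<in> subspaces_of_dim scale 1 \<longleftrightarrow> (\<exists>x. x \<noteq> 0 \<and> S = span {x})"
proof
  assume S: "S \<in> subspaces_of_dim scale 1"
  then have sub: "subspace S" and d: "dim S = 1"
    by (auto simp: subspaces_of_dim_def)
  obtain B where B: "B \<subseteq> S" "independent B" "S \<subseteq> span B" "card B = dim S"
    using basis_exists by blast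
  then obtain x where x: "B = {x}"
    using d by (metis card_1_singletonE)
  with B have "x \<noteq> 0"
    using dependent_zero by blast
  moreover have "S = span {x}"
    using B x sub by (meson span_minimal subset_antisym)
  ultimately show "\<exists>x. x \<noteq> 0 \<and> S = span {x}" by blast
next
  assume "\<exists>x. x \<noteq> 0 \<and> S = span {x}"
  then obtain x where x: "x \<noteq> 0" "S = span {x}" by blast
  then show "S \<in> subspaces_of_dim scale 1"
    using dim_span_eq_card_independent[of "{x}"]
    by (simp add: subspaces_of_dim_def)
qed

lemma span_insert_in_subspaces_of_dim:
  assumes "finite B" "independent B" "x \<notin> span B"
  shows "span (insert x B) \<in> subspaces_of_dim scale (Suc (card B))"
proof -
  have "independent (insert x B)"
    using assms independent_insertI by blast
  moreover have "x \<notin> B"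
    using assms(3) span_base by blast
  ultimately show ?thesis
    using assms(1) dim_span_eq_card_independent[of "insert x B"]
    by (simp add: subspaces_of_dim_def)
qed

lemma span_pair_in_subspaces_of_dim:
  assumes "x \<noteq> 0" "y \<notin> span {x}"
  shows "span {y, x} \<in> subspaces_of_dim scale 2"
  using span_insert_in_subspaces_of_dim[of "{x}" y] assms by (simp add: numeral_2_eq_2)

end

abbreviation (input) star :: "('k::field ^ 4) set \<Rightarrow> ('k ^ 4) set set" where
  "star P \<equiv> {L \<in> pg3_lines. P \<subseteq> L}"

lemma pg3_pointE:
  assumes "P \<in> pg3_points"
  obtains x where "x \<noteq> 0" "P = vec.span {x}"
  using assms vec.subspaces_of_dim_1_iff by blast

lemma span_singleton_point: "x \<noteq> 0 \<Longrightarrow> vec.span {x} \<in> pg3_points"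
  using vec.subspaces_of_dim_1_iff by blast

lemma span_singleton_subset_iff:
  "vec.subspace S \<Longrightarrow> vec.span {x} \<subseteq> S \<longleftrightarrow> x \<in> S"
  by (meson empty_subsetI insert_subset vec.span_base vec.span_minimal singletonI subsetD)

lemma pg3_subspace: "S \<in> subspaces_of_dim (*s) k \<Longrightarrow> vec.subspace S"
  by (simp add: subspaces_of_dim_def)

lemma pg3_dim: "S \<in> subspaces_of_dim (*s) k \<Longrightarrow> vec.dim S = k"
  by (simp add: subspaces_of_dim_def)

lemma dim_UNIV_4: "vec.dim (UNIV :: ('k::field ^ 4) set) = 4"
  by (simp only: vec_dim_card) simp

lemma pg3_eqI:
  assumes "S \<in> subspaces_of_dim (*s) k" "T \<in> subspaces_of_dim (*s) k" "S \<subseteq> T"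
  shows "S = (T :: ('k::field ^ 'n) set)"
  using assms by (simp add: subspaces_of_dim_def vec.subspace_dim_equal)

lemma line_span_pair:
  assumes "x \<noteq> (0 :: 'k::field ^ 4)" "y \<notin> vec.span {x}"
  shows "vec.span {y, x} \<in> pg3_lines" "vec.span {x} \<subseteq> vec.span {y, x}" "y \<in> vec.span {y, x}"
  using vec.span_pair_in_subspaces_of_dim[OF assms] vec.span_mono[of "{x}" "{y, x}"]
  by (auto intro: vec.span_base)

lemma join_points:
  assumes "P \<in> pg3_points" "Q \<in> pg3_points" "P \<noteq> Q"
  shows "vec.span (P \<union> Q) \<in> (pg3_lines :: ('k::field ^ 4) set set)"
proof -
  obtain x y where x: "x \<noteq> 0" "P = vec.span {x}" and y: "y \<noteq> 0" "Q = vec.span {y}"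
    using assms pg3_pointE by metis
  have "y \<notin> vec.span {x}"
  proof
    assume "y \<in> vec.span {x}"
    then have "Q \<subseteq> P" using x y by (simp add: span_singleton_subset_iff)
    then show False using assms pg3_eqI by blast
  qed
  moreover have "vec.span (P \<union> Q) = vec.span {y, x}"
    using vec.span_mono[of "{x}" "{y, x}"] vec.span_mono[of "{y}" "{y, x}"]
      vec.span_base[of x "{x}"] vec.span_base[of y "{y}"]
    unfolding x y by (intro subset_antisym vec.span_minimal) (auto intro: vec.span_base)
  ultimately show ?thesis using line_span_pair(1) x(1) by simp
qed

lemma line_eq_join:
  assumes "P \<in> pg3_points" "Q \<in> pg3_points" "P \<noteq> Q"
    and "L \<in> pg3_lines" "P \<subseteq> L" "Q \<subseteq> L"
  shows "L = vec.span (P \<union> (Q :: ('k::field ^ 4) set))"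
proof -
  have "vec.span (P \<union> Q) \<subseteq> L"
    using assms by (intro vec.span_minimal) (auto dest: pg3_subspace)
  then show ?thesis
    using pg3_eqI[OF join_points[OF assms(1-3)] assms(4)] by simp
qed

lemma two_points_line_unique:
  assumes "P \<in> pg3_points" "Q \<in> pg3_points" "P \<noteq> (Q :: ('k::field ^ 4) set)"
    and "L \<in> star P" "L \<in> star Q" "M \<in> star P" "M \<in> star Q"
  shows "L = M"
  using assms line_eq_join[of P Q L] line_eq_join[of P Q M] by simp

lemma two_lines_point_unique:
  assumes "L \<in> pg3_lines" "M \<in> pg3_lines" "L \<noteq> M"
    and "P \<in> pg3_points" "Q \<in> pg3_points" "P \<subseteq> L" "P \<subseteq> M" "Q \<subseteq> L" "Q \<subseteq> M"
  shows "P = (Q :: ('k::field ^ 4) set)"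
  using assms two_points_line_unique[of P Q L M] by blast

lemma join_exists:
  assumes "P \<in> pg3_points" "Q \<in> (pg3_points :: ('k::field ^ 4) set set)" "P \<noteq> Q"
  obtains L where "L \<in> star P" "L \<in> star Q"
  using join_points[OF assms] vec.span_superset by blast

section \<open>Meeting lines, stars and ruled planes\<close>

lemma lines_meet_iff:
  "lines_meet L M \<longleftrightarrow> (\<exists>P\<in>pg3_points. P \<subseteq> L \<and> P \<subseteq> M)"
  by (auto simp: lines_meet_def points_on_def)

text \<open>By the dimension formula: \<open>S + T\<close> lies in \<open>U\<close>, so the bound on
  dimensions leaves a nonzero vector in \<open>S \<inter> T\<close>, and this vector spans the
  point.\<close>

lemma common_point:
  assumes "vec.subspace S" "vec.subspace T" "vec.subspace U" "S \<subseteq> U" "T \<subseteq> U"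
    and "vec.dim U < vec.dim S + vec.dim T"
  obtains P where "P \<in> (pg3_points :: ('k::field ^ 4) set set)" "P \<subseteq> S" "P \<subseteq> T"
proof -
  have "{x + y | x y. x \<in> S \<and> y \<in> T} \<subseteq> U"
    using assms vec.subspace_add by blast
  then have "vec.dim {x + y | x y. x \<in> S \<and> y \<in> T} \<le> vec.dim U"
    by (rule vec.dim_subset)
  moreover have "vec.dim {x + y | x y. x \<in> S \<and> y \<in> T} + vec.dim (S \<inter> T) = vec.dim S + vec.dim T"
    using vec.dim_sums_Int[OF assms(1,2)] .
  ultimately have "vec.dim (S \<inter> T) \<noteq> 0" using assms(6) by linarith
  then obtain x where "x \<in> S \<inter> T" "x \<noteq> 0"
    unfolding vec.dim_eq_0 by blast
  then show ?thesis
    using that[OF span_singleton_point, of x] assms(1,2) by (simp add: span_singleton_subset_iff)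
qed

lemma subspace_dim_less_exists:
  assumes "vec.subspace S" "vec.subspace T" "vec.dim S < vec.dim (T :: ('k::field ^ 'n) set)"
  obtains x where "x \<in> T" "x \<notin> S"
  using assms vec.dim_subset[of T S] by fastforce

text \<open>Join \<open>P\<close> to a vector of \<open>T\<close> outside \<open>S\<close>. The
  choice of \<open>S\<close> steers the new line away from what is already there: the point itself,
  a first line, or the span of a point and a line.\<close>

lemma line_through_point:
  assumes "P \<in> pg3_points" "vec.subspace S" "vec.subspace T" "P \<subseteq> S" "P \<subseteq> T"
    and "vec.dim S < vec.dim (T :: ('k::field ^ 4) set)"
  obtains L where "L \<in> star P" "L \<subseteq> T" "\<not> L \<subseteq> S"
proof -
  obtain y where y: "y \<in> T" "y \<notin> S"
    using subspace_dim_less_exists assms by blast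
  obtain x where x: "x \<noteq> 0" "P = vec.span {x}"
    using assms pg3_pointE by metis
  have "y \<notin> vec.span {x}" using x y assms by blast
  note l = line_span_pair[OF x(1) this]
  have "x \<in> T" using assms x by (simp add: span_singleton_subset_iff)
  then have "vec.span {y, x} \<subseteq> T"
    using y assms by (intro vec.span_minimal) auto
  then show ?thesis using that[of "vec.span {y, x}"] l x y by blast
qed

lemma two_lines_in_plane:
  assumes "P \<in> pg3_points" "\<sigma> \<in> pg3_planes" "P \<subseteq> (\<sigma> :: ('k::field ^ 4) set)"
  obtains L M where "L \<in> star P" "M \<in> star P" "L \<noteq> M" "L \<subseteq> \<sigma>" "M \<subseteq> \<sigma>"
proof -
  note dims = pg3_subspace[OF assms(1)] pg3_subspace[OF assms(2)] pg3_dim[OF assms(1)] pg3_dim[OF assms(2)]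
  obtain L where L: "L \<in> star P" "L \<subseteq> \<sigma>"
    by (rule line_through_point[of P P \<sigma>]) (use assms dims in auto)
  then have "vec.subspace L" "vec.dim L = 2" "P \<subseteq> L"
    using pg3_subspace pg3_dim by blast+
  then obtain M where "M \<in> star P" "M \<subseteq> \<sigma>" "\<not> M \<subseteq> L"
    using line_through_point[of P L \<sigma>] assms dims by auto
  with L that show ?thesis by blast
qed

lemma two_lines_through_point:
  assumes "P \<in> (pg3_points :: ('k::field ^ 4) set set)"
  obtains L M where "L \<in> star P" "M \<in> star P" "L \<noteq> M"
proof -
  note dims = pg3_subspace[OF assms(1)] pg3_dim[OF assms(1)]
  obtain L where L: "L \<in> star P"
    by (rule line_through_point[of P P UNIV]) (use assms dims in \<open>auto simp only: dim_UNIV_4 vec.subspace_UNIV\<close>)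
  then have "vec.subspace L" "vec.dim L = 2" "P \<subseteq> L"
    using pg3_subspace pg3_dim by blast+
  then obtain M where "M \<in> star P" "\<not> M \<subseteq> L"
    using line_through_point[of P L UNIV] assms unfolding dim_UNIV_4 by auto
  with L that show ?thesis by blast
qed

text \<open>Two distinct lines through \<open>P\<close> would both pass through \<open>Q\<close> as
  well, and they share only one point. So a point is determined by its lines.\<close>

lemma star_subset_imp_eq:
  assumes "P \<in> pg3_points" "Q \<in> (pg3_points :: ('k::field ^ 4) set set)" "star P \<subseteq> star Q"
  shows "P = Q"
proof -
  obtain L M where "L \<in> star P" "M \<in> star P" "L \<noteq> M"
    using two_lines_through_point[OF assms(1)] .
  then show ?thesis
    using two_lines_point_unique[of L M P Q] assms(1,2) subsetD[OF assms(3), of L]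
      subsetD[OF assms(3), of M] by simp
qed

text \<open>If \<open>P\<close> were off \<open>L\<close>, the two would span at most a plane
  \<open>S\<close>, and some line through \<open>P\<close> leaves \<open>S\<close>. It cannot meet
  \<open>L\<close>, since it would then be the join of two points of \<open>S\<close>. Thus
  incidence with \<open>P\<close> can be read off from meeting the lines of the star.\<close>

lemma line_meeting_star:
  assumes "P \<in> pg3_points" "L \<in> pg3_lines" "\<And>M. M \<in> star P \<Longrightarrow> lines_meet M L"
  shows "P \<subseteq> (L :: ('k::field ^ 4) set)"
proof (rule ccontr)
  assume nP: "\<not> P \<subseteq> L"
  obtain x where x: "x \<noteq> 0" "P = vec.span {x}"
    using assms pg3_pointE by metis
  define S where "S = vec.span (insert x L)"
  have "vec.dim S \<le> Suc (vec.dim L)"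
    unfolding S_def by (simp add: vec.dim_insert)
  then have "vec.dim S < vec.dim (UNIV :: ('k ^ 4) set)"
    unfolding dim_UNIV_4 using pg3_dim[OF assms(2)] by linarith
  moreover have PS: "P \<subseteq> S"
    unfolding x S_def by (intro vec.span_mono) auto
  ultimately obtain M where M: "M \<in> star P" "\<not> M \<subseteq> S"
    using line_through_point[of P S UNIV] assms S_def by auto
  obtain Q where Q: "Q \<in> pg3_points" "Q \<subseteq> M" "Q \<subseteq> L"
    using assms(3)[OF M(1)] by (auto simp: lines_meet_iff)
  have "Q \<noteq> P" using nP Q by blast
  then have "M = vec.span (P \<union> Q)"
    using line_eq_join[of P Q M] M Q assms by blast
  moreover have "Q \<subseteq> S" using Q unfolding S_def by (meson subset_insertI vec.span_superset order_trans)
  ultimately have "M \<subseteq> S"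
    using PS S_def by (metis Un_least vec.span_minimal vec.subspace_span)
  with M show False by blast
qed

lemma lines_in_plane_meet:
  assumes "L \<in> pg3_lines" "M \<in> pg3_lines" "\<sigma> \<in> pg3_planes" "L \<subseteq> \<sigma>" "M \<subseteq> (\<sigma> :: ('k::field ^ 4) set)"
  shows "lines_meet L M"
proof -
  have "vec.dim \<sigma> < vec.dim L + vec.dim M"
    using pg3_dim[OF assms(1)] pg3_dim[OF assms(2)] pg3_dim[OF assms(3)] by linarith
  then obtain P where "P \<in> pg3_points" "P \<subseteq> L" "P \<subseteq> M"
    by (rule common_point[OF pg3_subspace[OF assms(1)] pg3_subspace[OF assms(2)]
          pg3_subspace[OF assms(3)] assms(4,5)])
  then show ?thesis by (auto simp: lines_meet_iff)
qed

text \<open>One vector \<open>m\<close> of \<open>M\<close> outside \<open>L\<close> suffices to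
  generate the span over \<open>L\<close>, because the common point \<open>R\<close> supplies the
  other generator of \<open>M\<close>. So the dimension is 2 + 1.\<close>

lemma span_meeting_lines_plane:
  assumes "L \<in> pg3_lines" "M \<in> pg3_lines" "L \<noteq> M" "R \<in> pg3_points" "R \<subseteq> L" "R \<subseteq> M"
  shows "vec.span (L \<union> M) \<in> (pg3_planes :: ('k::field ^ 4) set set)"
proof -
  obtain r where r: "r \<noteq> 0" "R = vec.span {r}"
    using assms pg3_pointE by metis
  have sL: "vec.subspace L" "vec.dim L = 2" and sM: "vec.subspace M" "vec.dim M = 2"
    using assms by (auto simp: subspaces_of_dim_def)
  have "\<not> M \<subseteq> L" using pg3_eqI assms by blast
  then obtain m where m: "m \<in> M" "m \<notin> L" by blast
  have "m \<notin> vec.span {r}" using m assms r by blast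
  note l = line_span_pair[OF r(1) this]
  have "vec.span {m, r} \<subseteq> M"
    using m assms r sM by (intro vec.span_minimal) (auto simp: span_singleton_subset_iff)
  then have M: "M = vec.span {m, r}"
    using pg3_eqI[OF l(1) assms(2)] by simp
  have rL: "r \<in> L" using assms r sL by (simp add: span_singleton_subset_iff)
  have "vec.span (L \<union> M) = vec.span (insert m L)"
  proof (rule subset_antisym; rule vec.span_minimal)
    have "M \<subseteq> vec.span (insert m L)"
      unfolding M using rL by (intro vec.span_mono) auto
    then show "L \<union> M \<subseteq> vec.span (insert m L)"
      by (meson Un_least subset_insertI vec.span_superset order_trans)
    show "insert m L \<subseteq> vec.span (L \<union> M)"
      using m by (auto intro: vec.span_base)
  qed auto
  moreover have "vec.dim (insert m L) = 3"
    using m sL by (simp add: vec.dim_insert vec.span_eq_iff[THEN iffD2])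
  ultimately show ?thesis by (simp add: subspaces_of_dim_def)
qed

text \<open>The points \<open>A\<close> and \<open>B\<close> where \<open>L\<close> meets
  \<open>L1\<close> and \<open>L2\<close> are distinct, since a common one would be
  \<open>R\<close>, which is not on \<open>L\<close>. Hence \<open>L\<close> is their join.\<close>

lemma transversal_in_span:
  assumes "L1 \<in> star R" "L2 \<in> star R" "L1 \<noteq> L2" "R \<in> pg3_points"
    and "L \<in> pg3_lines" "lines_meet L L1" "lines_meet L L2" "\<not> R \<subseteq> L"
  shows "L \<subseteq> vec.span (L1 \<union> (L2 :: ('k::field ^ 4) set))"
proof -
  obtain A B where A: "A \<in> pg3_points" "A \<subseteq> L" "A \<subseteq> L1" and B: "B \<in> pg3_points" "B \<subseteq> L" "B \<subseteq> L2"
    using assms by (auto simp: lines_meet_iff)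
  have "A \<noteq> B"
    using two_lines_point_unique[of L1 L2 A R] assms A B by blast
  then have "L = vec.span (A \<union> B)"
    using line_eq_join A B assms by blast
  also have "\<dots> \<subseteq> vec.span (L1 \<union> L2)"
    using A B by (intro vec.span_mono) auto
  finally show ?thesis .
qed

text \<open>Let \<open>L1\<close> and \<open>L2\<close> meet in \<open>R\<close> and span
  \<open>\<sigma>\<close>. Every line of the clique passes through \<open>R\<close> or lies in
  \<open>\<sigma>\<close>. If some \<open>L3\<close> leaves \<open>\<sigma>\<close>, it passes
  through \<open>R\<close>; a line of the clique missing \<open>R\<close> would then meet
  \<open>L3\<close> in a second point of \<open>\<sigma>\<close> and force \<open>L3\<close> into
  \<open>\<sigma>\<close>.\<close>

lemma clique_in_star_or_plane:
  assumes C: "C \<subseteq> pg3_lines" and meet: "\<And>L M. L \<in> C \<Longrightarrow> M \<in> C \<Longrightarrow> lines_meet L M"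
    and "L1 \<in> C" "L2 \<in> C" "L1 \<noteq> L2"
  obtains (star) R where "R \<in> (pg3_points :: ('k::field ^ 4) set set)" "C \<subseteq> star R"
    | (plane) \<sigma> where "\<sigma> \<in> pg3_planes" "\<And>L. L \<in> C \<Longrightarrow> L \<subseteq> \<sigma>"
proof -
  obtain R where R: "R \<in> pg3_points" "R \<subseteq> L1" "R \<subseteq> L2"
    using meet[OF assms(3,4)] by (auto simp: lines_meet_iff)
  have L12: "L1 \<in> star R" "L2 \<in> star R" using R assms by auto
  define \<sigma> where "\<sigma> = vec.span (L1 \<union> L2)"
  have \<sigma>: "\<sigma> \<in> pg3_planes"
    unfolding \<sigma>_def using span_meeting_lines_plane R assms by blast
  have trans: "R \<subseteq> L \<or> L \<subseteq> \<sigma>" if "L \<in> C" for L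
    using transversal_in_span[OF L12 \<open>L1 \<noteq> L2\<close> R(1), of L] that assms \<sigma>_def by blast
  show ?thesis
  proof (cases "\<forall>L\<in>C. L \<subseteq> \<sigma>")
    case True
    then show ?thesis using plane \<sigma> by blast
  next
    case False
    then obtain L3 where L3: "L3 \<in> C" "\<not> L3 \<subseteq> \<sigma>" by blast
    then have RL3: "R \<subseteq> L3" using trans by blast
    have "R \<subseteq> L" if L: "L \<in> C" for L
    proof (rule ccontr)
      assume nR: "\<not> R \<subseteq> L"
      then have "L \<subseteq> \<sigma>" using trans L by blast
      obtain T where T: "T \<in> pg3_points" "T \<subseteq> L" "T \<subseteq> L3"
        using meet[OF L L3(1)] by (auto simp: lines_meet_iff)
      have "T \<noteq> R" using nR T by blast
      then have "L3 = vec.span (R \<union> T)"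
        using line_eq_join[of R T L3] R T RL3 L3 C by blast
      also have "\<dots> \<subseteq> \<sigma>"
        using T \<open>L \<subseteq> \<sigma>\<close> R pg3_subspace[OF \<sigma>] \<sigma>_def
        by (intro vec.span_minimal) (auto intro: vec.span_base)
      finally show False using L3 by blast
    qed
    then show ?thesis using star[of R] R C by blast
  qed
qed

section \<open>Counting vectors and points of a subspace\<close>

lemma card_span_independent:
  assumes "finite B" "vec.independent (B :: ('k::{field,finite} ^ 'n) set)"
  shows "card (vec.span B) = CARD('k) ^ card B"
  using assms
proof (induction B rule: finite_induct)
  case empty
  then show ?case by simp
next
  case (insert b B)
  have ind: "vec.independent B" and b: "b \<notin> vec.span B"
    using insert.prems insert.hyps vec.independent_insert[of b B] by simp_all
  \<comment> \<open>Coordinates with respect to the new basis vector: \<open>?h\<close> will be a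
    bijection onto the larger span, so each basis vector multiplies the count by the size of the
    field.\<close>
  let ?h = "\<lambda>(k, x). x + k *s b"
  have "inj_on ?h (UNIV \<times> vec.span B)"
  proof (rule inj_onI, clarify)
    fix k l x y assume x: "x \<in> vec.span B" and y: "y \<in> vec.span B" and eq: "x + k *s b = y + l *s b"
    have "k *s b = y + l *s b - x"
      unfolding eq[symmetric] by simp
    then have "(k - l) *s b = y - x"
      by (simp add: vec.scale_left_diff_distrib)
    then have "(k - l) *s b \<in> vec.span B" using vec.span_diff[OF y x] by simp
    moreover have "k = l" if "(k - l) *s b \<in> vec.span B"
    proof (rule ccontr)
      assume "k \<noteq> l"
      then have "inverse (k - l) *s ((k - l) *s b) = b"
        by (simp only: vec.scale_scale) simp
      then show False using vec.span_scale[OF that, of "inverse (k - l)"] b by simp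
    qed
    ultimately show "k = l \<and> x = y" using eq by auto
  qed
  moreover have "?h ` (UNIV \<times> vec.span B) = vec.span (insert b B)"
  proof -
    have "a \<in> vec.span (insert b B) \<longleftrightarrow> (\<exists>k. \<exists>x\<in>vec.span B. a = x + k *s b)" for a
      unfolding vec.span_insert mem_Collect_eq
      by (metis add_diff_cancel_right' diff_add_cancel)
    then show ?thesis by (fastforce simp: image_iff)
  qed
  ultimately have "card (vec.span (insert b B)) = card ((UNIV :: 'k set) \<times> vec.span B)"
    by (metis card_image)
  then show ?case using insert.IH[OF ind] insert.hyps by (simp add: card_cartesian_product)
qed

lemma card_subspace:
  assumes "S \<in> subspaces_of_dim (*s) k"
  shows "card (S :: ('k::{field,finite} ^ 'n) set) = CARD('k) ^ k"
proof -
  have sub: "vec.subspace S" and d: "vec.dim S = k"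
    using assms by (auto simp: subspaces_of_dim_def)
  obtain B where B: "B \<subseteq> S" "vec.independent B" "S \<subseteq> vec.span B" "card B = vec.dim S"
    using vec.basis_exists by blast
  then have "S = vec.span B" using sub by (meson vec.span_minimal subset_antisym)
  then show ?thesis using card_span_independent[of B] B d by simp
qed

text \<open>The points of \<open>S\<close> with the zero vector removed partition the nonzero
  vectors of \<open>S\<close> into classes of size \<open>CARD('k) - 1\<close>. The product form
  avoids a division.\<close>

lemma card_points_on:
  assumes "S \<in> subspaces_of_dim (*s) k"
  shows "card (points_on (S :: ('k::{field,finite} ^ 4) set)) * (CARD('k) - 1) = CARD('k) ^ k - 1"
proof -
  have sub: "vec.subspace S" using assms by (rule pg3_subspace)
  have card0: "card (T - {0}) = CARD('k) ^ j - 1" if "T \<in> subspaces_of_dim (*s) j" for T :: "('k ^ 4) set" and j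
    using card_subspace[OF that] vec.subspace_0[OF pg3_subspace[OF that]] by (simp add: card_Diff_subset)
  have "(\<Union>P\<in>points_on S. P - {0}) = S - {0}"
  proof (intro subset_antisym subsetI)
    fix x assume "x \<in> S - {0}"
    then have "vec.span {x} \<in> points_on S" "x \<in> vec.span {x} - {0}"
      using span_singleton_point[of x] span_singleton_subset_iff[OF sub, of x] vec.span_base[of x "{x}"]
      unfolding points_on_def by auto
    then show "x \<in> (\<Union>P\<in>points_on S. P - {0})" by blast
  qed (auto simp: points_on_def)
  moreover have "card (\<Union>P\<in>points_on S. P - {0}) = (\<Sum>P\<in>points_on S. card (P - {0}))"
  proof (rule card_UN_disjoint)
    show "\<forall>P\<in>points_on S. \<forall>Q\<in>points_on S. P \<noteq> Q \<longrightarrow> (P - {0}) \<inter> (Q - {0}) = {}"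
    proof (intro ballI impI, rule ccontr)
      fix P Q assume PQ: "P \<in> points_on S" "Q \<in> points_on S" "P \<noteq> Q" "(P - {0}) \<inter> (Q - {0}) \<noteq> {}"
      then obtain x where x: "x \<noteq> 0" "x \<in> P" "x \<in> Q" by blast
      have pt: "P \<in> pg3_points" "Q \<in> pg3_points" using PQ by (auto simp: points_on_def)
      have "vec.span {x} = P" "vec.span {x} = Q"
        using pg3_eqI[OF span_singleton_point[OF x(1)] pt(1)] span_singleton_subset_iff[OF pg3_subspace[OF pt(1)]]
          pg3_eqI[OF span_singleton_point[OF x(1)] pt(2)] span_singleton_subset_iff[OF pg3_subspace[OF pt(2)]]
          x by blast+
      with PQ show False by simp
    qed
  qed auto
  moreover have "card (P - {0}) = CARD('k) - 1" if "P \<in> points_on S" for P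
    using card0[of P 1] that unfolding points_on_def by simp
  ultimately show ?thesis using card0[OF assms] by simp
qed

lemma UNIV_subspaces_of_dim_4: "(UNIV :: ('k::field ^ 4) set) \<in> subspaces_of_dim (*s) 4"
  unfolding subspaces_of_dim_def using dim_UNIV_4 vec.subspace_UNIV by blast

section \<open>Collineations from line permutations\<close>

text \<open>Preserving the relation of meeting does not by itself single out collineations: a
  correlation does so too, but maps stars to ruled planes. The invariance of the star of
  \<open>p\<close> excludes this.\<close>

locale line_permutation =
  fixes \<psi> :: "('k::{field,finite} ^ 4) set \<Rightarrow> ('k ^ 4) set" and p :: "('k ^ 4) set"
  assumes bij: "bij_betw \<psi> pg3_lines pg3_lines"
    and meet_iff: "L \<in> pg3_lines \<Longrightarrow> M \<in> pg3_lines \<Longrightarrow> lines_meet (\<psi> L) (\<psi> M) \<longleftrightarrow> lines_meet L M"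
    and p_point: "p \<in> pg3_points"
    and p_iff: "L \<in> pg3_lines \<Longrightarrow> p \<subseteq> \<psi> L \<longleftrightarrow> p \<subseteq> L"
begin

lemma image_line: "L \<in> pg3_lines \<Longrightarrow> \<psi> L \<in> pg3_lines"
  using bij by (rule bij_betwE[THEN bspec])

lemma preimage_line:
  assumes "M \<in> pg3_lines"
  obtains L where "L \<in> pg3_lines" "M = \<psi> L"
  using bij assms by (metis bij_betw_imp_surj_on image_iff)

lemma image_line_eq_iff: "L \<in> pg3_lines \<Longrightarrow> M \<in> pg3_lines \<Longrightarrow> \<psi> L = \<psi> M \<longleftrightarrow> L = M"
  using bij by (metis bij_betw_imp_inj_on inj_on_eq_iff)

definition corresponds :: "('k ^ 4) set \<Rightarrow> ('k ^ 4) set \<Rightarrow> bool" where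
  "corresponds P Q \<longleftrightarrow> P \<in> pg3_points \<and> Q \<in> pg3_points \<and> (\<forall>L\<in>pg3_lines. P \<subseteq> L \<longleftrightarrow> Q \<subseteq> \<psi> L)"

lemma corresponds_iff: "corresponds P Q \<Longrightarrow> L \<in> pg3_lines \<Longrightarrow> P \<subseteq> L \<longleftrightarrow> Q \<subseteq> \<psi> L"
  unfolding corresponds_def by blast

lemma corresponds_p: "corresponds p p"
  unfolding corresponds_def using p_point p_iff by simp

text \<open>The image of a star is a maximal clique, so it is a star or the set of lines in a plane; the
  latter is impossible because the star has exactly one line in common with the star of \<open>p\<close>.\<close>

lemma corresponds_exists:
  assumes P: "P \<in> pg3_points"
  shows "\<exists>Q. corresponds P Q"
proof (cases "P = p")
  case True
  then show ?thesis using corresponds_p by blast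
next
  case False
  \<comment> \<open>This is the maximality of the clique \<open>star P\<close>, expressed through
    the images under \<open>\<psi>\<close>.\<close>
  have max: "P \<subseteq> L" if "L \<in> pg3_lines" "\<And>M. M \<in> star P \<Longrightarrow> lines_meet (\<psi> M) (\<psi> L)" for L
    using line_meeting_star[OF P that(1)] that meet_iff by simp
  obtain L1 L2 where L12: "L1 \<in> star P" "L2 \<in> star P" "L1 \<noteq> L2"
    using two_lines_through_point[OF P] .
  have clique: "lines_meet L M" if "L \<in> \<psi> ` star P" "M \<in> \<psi> ` star P" for L M
    using that P by (auto simp: meet_iff) (auto simp: lines_meet_iff)
  have sub: "\<psi> ` star P \<subseteq> pg3_lines" using image_line by auto
  have neq: "\<psi> L1 \<noteq> \<psi> L2" using L12 image_line_eq_iff by simp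
  have mem: "\<psi> L1 \<in> \<psi> ` star P" "\<psi> L2 \<in> \<psi> ` star P"
    using imageI[OF L12(1)] imageI[OF L12(2)] by this
  show ?thesis
  proof (rule clique_in_star_or_plane[OF sub clique mem neq])
    fix R assume R: "R \<in> pg3_points" "\<psi> ` star P \<subseteq> star R"
    have fw: "R \<subseteq> \<psi> L" if "L \<in> star P" for L
      using R(2) that by (metis (no_types, lifting) imageI mem_Collect_eq subsetD)
    have "P \<subseteq> L" if L: "L \<in> pg3_lines" "R \<subseteq> \<psi> L" for L
    proof (rule max[OF L(1)])
      fix M assume "M \<in> star P"
      then show "lines_meet (\<psi> M) (\<psi> L)"
        unfolding lines_meet_iff using R(1) fw[of M] L(2) by auto
    qed
    then have "P \<subseteq> L \<longleftrightarrow> R \<subseteq> \<psi> L" if "L \<in> pg3_lines" for L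
      using fw[of L] that by (intro iffI) simp_all
    then have "corresponds P R"
      unfolding corresponds_def using P R(1) by simp
    then show "\<exists>Q. corresponds P Q" ..
  next
    fix \<sigma> assume \<sigma>: "\<sigma> \<in> pg3_planes" "\<And>L. L \<in> \<psi> ` star P \<Longrightarrow> L \<subseteq> \<sigma>"
    have bw: "P \<subseteq> L" if L: "L \<in> pg3_lines" "\<psi> L \<subseteq> \<sigma>" for L
    proof (rule max[OF L(1)])
      fix M assume M: "M \<in> star P"
      then show "lines_meet (\<psi> M) (\<psi> L)"
        using lines_in_plane_meet[OF image_line image_line[OF L(1)] \<sigma>(1) \<sigma>(2) L(2), of M] by simp
    qed
    \<comment> \<open>The image of the line joining \<open>P\<close> and \<open>p\<close> passes
      through \<open>p\<close> and lies in \<open>\<sigma>\<close>, so \<open>p\<close> is in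
      \<open>\<sigma>\<close>. Two lines of \<open>\<sigma>\<close> through \<open>p\<close> then
      pull back to lines through both \<open>P\<close> and \<open>p\<close>, which cannot be
      distinct.\<close>
    obtain N where N: "N \<in> star P" "N \<in> star p"
      using join_exists[OF P p_point False] .
    then have "p \<subseteq> \<psi> N" "\<psi> N \<subseteq> \<sigma>"
      using p_iff \<sigma>(2)[OF imageI, of N] by simp_all
    then have "p \<subseteq> \<sigma>" by (rule order_trans)
    then obtain L M where LM: "L \<in> star p" "M \<in> star p" "L \<noteq> M" "L \<subseteq> \<sigma>" "M \<subseteq> \<sigma>"
      by (rule two_lines_in_plane[OF p_point \<sigma>(1)])
    have "L \<in> pg3_lines" "M \<in> pg3_lines" using LM by simp_all
    then obtain L' M' where L': "L' \<in> pg3_lines" "L = \<psi> L'" and M': "M' \<in> pg3_lines" "M = \<psi> M'"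
      using preimage_line by metis
    have "L' = M'"
      using two_points_line_unique[OF P p_point False, of L' M'] L' M' LM p_iff bw by simp
    then show "\<exists>Q. corresponds P Q" using LM L' M' by simp
  qed
qed

text \<open>A one-sided condition on \<open>Q\<close> is enough: as \<open>\<psi>\<close> is onto,
  it gives \<open>star R \<subseteq> star Q\<close>, and this inclusion already forces equality of
  the points.\<close>

lemma corresponds_unique:
  assumes "Q \<in> pg3_points" "corresponds P R" "\<And>L. L \<in> star P \<Longrightarrow> Q \<subseteq> \<psi> L"
  shows "Q = R"
proof -
  have "star R \<subseteq> star Q"
  proof
    fix M assume M: "M \<in> star R"
    then obtain L where "L \<in> pg3_lines" "M = \<psi> L" using preimage_line by blast
    then show "M \<in> star Q" using M assms(2,3) unfolding corresponds_def by simp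
  qed
  then show ?thesis
    using star_subset_imp_eq[of R Q] assms(1,2) unfolding corresponds_def by metis
qed

lemma corresponds_inj:
  assumes "corresponds P R" "corresponds Q R"
  shows "P = Q"
proof (rule star_subset_imp_eq)
  show "P \<in> pg3_points" "Q \<in> pg3_points"
    using assms unfolding corresponds_def by simp_all
  show "star P \<subseteq> star Q"
  proof
    fix L assume "L \<in> star P"
    then show "L \<in> star Q"
      using corresponds_iff[OF assms(1), of L] corresponds_iff[OF assms(2), of L] by simp
  qed
qed

text \<open>The restriction to \<open>pg3_points\<close> matches the convention of
  \<open>Bij\<close> that maps are \<open>undefined\<close> elsewhere.\<close>

definition induced :: "('k ^ 4) set \<Rightarrow> ('k ^ 4) set" where
  "induced = (\<lambda>P\<in>pg3_points. SOME Q. corresponds P Q)"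

lemma corresponds_induced: "P \<in> pg3_points \<Longrightarrow> corresponds P (induced P)"
  unfolding induced_def using someI_ex[OF corresponds_exists] by simp

lemma induced_point: "P \<in> pg3_points \<Longrightarrow> induced P \<in> pg3_points"
  using corresponds_induced corresponds_def by blast

lemma induced_subset_iff:
  "P \<in> pg3_points \<Longrightarrow> L \<in> pg3_lines \<Longrightarrow> induced P \<subseteq> \<psi> L \<longleftrightarrow> P \<subseteq> L"
  using corresponds_iff[OF corresponds_induced] by simp

lemma induced_Bij: "induced \<in> Bij pg3_points"
proof -
  have inj: "inj_on induced pg3_points"
    by (rule inj_onI) (metis corresponds_induced corresponds_inj)
  \<comment> \<open>The set of points is finite, so an injective map of it into itself is
    onto.\<close>
  have "induced ` pg3_points = pg3_points"
    by (rule endo_inj_surj[OF _ _ inj]) (auto simp: induced_point simp del: One_nat_def)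
  then show ?thesis
    using inj unfolding Bij_def bij_betw_def induced_def by simp
qed

lemma induced_points_on:
  assumes "L \<in> pg3_lines"
  shows "induced ` points_on L = points_on (\<psi> L)"
proof (intro subset_antisym subsetI)
  fix Q assume "Q \<in> induced ` points_on L"
  then obtain P where "P \<in> pg3_points" "P \<subseteq> L" "Q = induced P"
    unfolding points_on_def by auto
  then show "Q \<in> points_on (\<psi> L)"
    using assms induced_point induced_subset_iff unfolding points_on_def by simp
next
  fix Q assume Q: "Q \<in> points_on (\<psi> L)"
  then have "Q \<in> induced ` pg3_points"
    using induced_Bij unfolding points_on_def Bij_def bij_betw_def by simp
  then obtain P where "P \<in> pg3_points" "Q = induced P" by blast
  then show "Q \<in> induced ` points_on L"
    using Q assms induced_subset_iff unfolding points_on_def by simp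
qed

lemma induced_collineation: "induced \<in> collineations"
proof -
  have inj: "inj_on induced pg3_points"
    using induced_Bij unfolding Bij_def bij_betw_def by simp
  have "inj_on (image induced) (points_on ` pg3_lines)"
    by (rule inj_on_subset[OF inj_on_image_Pow[OF inj]]) (auto simp: points_on_def)
  moreover have "image induced ` points_on ` pg3_lines = points_on ` \<psi> ` pg3_lines"
    by (simp add: image_image induced_points_on)
  ultimately show ?thesis
    using induced_Bij bij unfolding collineations_def bij_betw_def by simp
qed

text \<open>Gives the uniqueness half of the definite description in \<open>klein_action\<close>.
  The image of a point lies on the images of all its lines, so \<open>corresponds_unique\<close>
  applies.\<close>

lemma collineation_eq_induced:
  assumes "h \<in> collineations" and im: "\<And>L. L \<in> pg3_lines \<Longrightarrow> h ` points_on L = points_on (\<psi> L)"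
  shows "h = induced"
proof (rule extensionalityI[where A = pg3_points])
  have h: "h \<in> Bij pg3_points" using assms unfolding collineations_def by simp
  show "h \<in> extensional pg3_points" "induced \<in> extensional pg3_points"
    using h induced_Bij Bij_imp_extensional by blast+
  fix P :: "('k ^ 4) set" assume P: "P \<in> pg3_points"
  show "h P = induced P"
  proof (rule corresponds_unique[OF _ corresponds_induced[OF P]])
    show "h P \<in> pg3_points" using h P Bij_imp_funcset by blast
    fix L assume "L \<in> star P"
    then have "h P \<in> points_on (\<psi> L)"
      using im[of L] P imageI[of P "points_on L" h] unfolding points_on_def by auto
    then show "h P \<subseteq> \<psi> L" unfolding points_on_def by simp
  qed
qed

end

section \<open>Cubic extensions of finite fields\<close>

text \<open>Multiplication by \<open>x\<close> permutes the nonzero elements; compare their product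
  before and after.\<close>

lemma finite_field_power_card_minus_1:
  fixes x :: "'a::{field,finite}"
  assumes "x \<noteq> 0"
  shows "x ^ (CARD('a) - 1) = 1"
proof -
  have "(\<Prod>y\<in>UNIV - {0}. x * y) = (\<Prod>y\<in>UNIV - {0::'a}. y)"
    by (rule prod.reindex_bij_witness[of _ "\<lambda>y. y / x" "\<lambda>y. x * y"]) (use assms in auto)
  then have "x ^ (CARD('a) - 1) * (\<Prod>y\<in>UNIV - {0::'a}. y) = (\<Prod>y\<in>UNIV - {0::'a}. y)"
    by (simp add: prod.distrib)
  moreover have "(\<Prod>y\<in>UNIV - {0::'a}. y) \<noteq> 0" by simp
  ultimately show ?thesis by simp
qed

lemma finite_field_power_card: "x ^ CARD('a) = (x :: 'a::{field,finite})"
proof (cases "x = 0")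
  case False
  have "x ^ CARD('a) = x * x ^ (CARD('a) - 1)"
    by (metis Suc_diff_1 power_Suc zero_less_card_finite)
  then show ?thesis using finite_field_power_card_minus_1[OF False] by simp
qed simp

text \<open>The polynomial \<open>(X + 1)^q - X^q - 1\<close> has degree less than \<open>q\<close> and vanishes on the whole field.\<close>

lemma finite_field_binomial_eq_0:
  assumes "0 < k" "k < CARD('a)"
  shows "of_nat (CARD('a) choose k) = (0 :: 'a::{field,finite})"
proof -
  define q where "q = CARD('a)"
  have q0: "0 < q" by (simp add: q_def)
  define R where "R = (\<Sum>i\<in>{1..<q}. monom (of_nat (q choose i) :: 'a) i)"
  have "degree R \<le> q - 1"
    unfolding R_def by (intro degree_sum_le) (auto intro: order_trans[OF degree_monom_le])
  then have deg: "degree R < card (UNIV :: 'a set)" using q0 by (simp add: q_def[symmetric])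
  have roots: "poly R x = 0" for x
  proof -
    have "(\<Sum>i\<le>q. of_nat (q choose i) * x ^ i) = (x + 1) ^ q"
      by (simp add: binomial_ring)
    also have "\<dots> = x + 1" unfolding q_def by (rule finite_field_power_card)
    finally have sum: "(\<Sum>i\<le>q. of_nat (q choose i) * x ^ i) = x + 1" .
    have "{..q} = insert 0 (insert q {1..<q})" using q0 by auto
    then have "(\<Sum>i\<le>q. of_nat (q choose i) * x ^ i) = 1 + (x ^ q + (\<Sum>i\<in>{1..<q}. of_nat (q choose i) * x ^ i))"
      using q0 by simp
    with sum have "(\<Sum>i\<in>{1..<q}. of_nat (q choose i) * x ^ i) = 0"
      using finite_field_power_card[of x] by (simp add: q_def)
    then show ?thesis by (simp add: R_def poly_sum poly_monom)
  qed
  have "R = 0"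
    by (rule poly_eqI_degree[of UNIV]) (use deg roots in auto)
  then have "coeff R k = 0" by simp
  then show ?thesis
    using assms by (simp add: R_def coeff_sum q_def if_distrib sum.delta cong: if_cong)
qed

lemma field_embedding_of_nat: "field_embedding \<iota> \<Longrightarrow> \<iota> (of_nat n) = of_nat n"
proof (induction n)
  case 0
  then have "\<iota> (0 + 0) = \<iota> 0 + \<iota> 0" unfolding field_embedding_def by blast
  then have "\<iota> 0 + \<iota> 0 = \<iota> 0 + 0" by (simp only: add_0 add_0_right)
  then show ?case by (simp only: add_left_cancel of_nat_0)
qed (simp add: field_embedding_def)

lemma field_embedding_0: "field_embedding \<iota> \<Longrightarrow> \<iota> 0 = 0"
  using field_embedding_of_nat[of \<iota> 0] by simp

lemma field_embedding_eq_0_iff: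
  assumes "field_embedding \<iota>"
  shows "\<iota> a = 0 \<longleftrightarrow> a = 0"
proof
  assume "\<iota> a = 0"
  show "a = 0"
  proof (rule ccontr)
    assume "a \<noteq> 0"
    then have "\<iota> 1 = \<iota> a * \<iota> (inverse a)"
      using assms unfolding field_embedding_def by (metis right_inverse)
    then show False using assms \<open>\<iota> a = 0\<close> unfolding field_embedding_def by simp
  qed
qed (simp add: field_embedding_0[OF assms])

lemma field_embedding_diff: "field_embedding \<iota> \<Longrightarrow> \<iota> (a - b) = \<iota> a - \<iota> b"
  unfolding field_embedding_def by (metis add_diff_cancel_right' diff_add_cancel)

lemma field_embedding_inj: "field_embedding \<iota> \<Longrightarrow> inj \<iota>"
  by (rule injI) (metis field_embedding_diff field_embedding_eq_0_iff right_minus_eq)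

lemma field_embedding_power: "field_embedding \<iota> \<Longrightarrow> \<iota> (a ^ n) = \<iota> a ^ n"
  by (induction n) (simp_all add: field_embedding_def)

text \<open>The inner binomial coefficients vanish in the smaller field, and \<open>\<iota>\<close>
  carries this to the larger one. So the Frobenius map is additive, with no appeal to the
  characteristic.\<close>

lemma power_card_add:
  fixes \<iota> :: "'f::{field,finite} \<Rightarrow> 'e::field"
  assumes "field_embedding \<iota>"
  shows "(x + y :: 'e) ^ CARD('f) = x ^ CARD('f) + y ^ CARD('f)"
proof -
  define q where "q = CARD('f)"
  have q0: "0 < q" by (simp add: q_def)
  have z: "of_nat (q choose i) = (0 :: 'e)" if "i \<in> {1..<q}" for i
    using finite_field_binomial_eq_0[of i, where 'a = 'f] that field_embedding_of_nat[OF assms, of "q choose i"]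
      field_embedding_0[OF assms] by (simp add: q_def)
  have "(x + y) ^ q = (\<Sum>i\<le>q. of_nat (q choose i) * x ^ i * y ^ (q - i))"
    by (rule binomial_ring)
  also have "{..q} = insert 0 (insert q {1..<q})" using q0 by auto
  also have "(\<Sum>i\<in>insert 0 (insert q {1..<q}). of_nat (q choose i) * x ^ i * y ^ (q - i)) = y ^ q + x ^ q"
    using q0 by (simp add: z)
  finally show ?thesis by (simp add: q_def)
qed

lemma power_mod_exponent:
  fixes x :: "'a::monoid_mult"
  assumes "x ^ m = 1"
  shows "x ^ (n mod m) = x ^ n"
proof -
  have "x ^ n = x ^ (m * (n div m) + n mod m)" by simp
  also have "\<dots> = x ^ (n mod m)"
    by (simp only: power_add power_mult assms power_one mult_1)
  finally show ?thesis ..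
qed

lemma power_mult_exponent_eq_1:
  fixes x :: "'a::monoid_mult"
  assumes "x ^ m = 1"
  shows "x ^ (m * n) = 1"
  by (simp only: power_mult assms power_one)

section \<open>Diagonal maps of \<open>E^2\<close> as permutations\<close>

definition diag_map :: "'e::field \<Rightarrow> 'e \<Rightarrow> 'e \<times> 'e \<Rightarrow> 'e \<times> 'e" where
  "diag_map a b = (\<lambda>(u, v). (a * u, b * v))"

lemma diag_map_simp [simp]: "diag_map a b (u, v) = (a * u, b * v)"
  by (simp add: diag_map_def)

lemma diag_map_eq_iff: "diag_map a b = diag_map a' b' \<longleftrightarrow> a = a' \<and> b = b'"
proof
  assume "diag_map a b = diag_map a' b'"
  then have "diag_map a b (1, 1) = diag_map a' b' (1, 1)" by simp
  then show "a = a' \<and> b = b'" by simp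
qed simp

lemma diag_map_comp: "diag_map a b \<circ> diag_map a' b' = diag_map (a * a') (b * b')"
  by (auto simp: fun_eq_iff mult.assoc)

lemma diag_map_bij:
  assumes "a \<noteq> 0" "b \<noteq> 0"
  shows "bij (diag_map a b)"
  by (rule bij_betw_byWitness[where f' = "diag_map (inverse a) (inverse b)"])
    (use assms in \<open>auto simp: field_simps\<close>)

lemma diag_map_Bij: "a \<noteq> 0 \<Longrightarrow> b \<noteq> 0 \<Longrightarrow> diag_map a b \<in> Bij UNIV"
  by (simp add: Bij_def diag_map_bij)

lemma BijGroup_UNIV_mult:
  assumes "f \<in> Bij UNIV" "g \<in> Bij UNIV"
  shows "f \<otimes>\<^bsub>BijGroup UNIV\<^esub> g = f \<circ> g"
  using assms by (auto simp: BijGroup_def compose_def fun_eq_iff)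

lemma diag_map_mult:
  assumes "a \<noteq> 0" "b \<noteq> 0" "a' \<noteq> 0" "b' \<noteq> 0"
  shows "diag_map a b \<otimes>\<^bsub>BijGroup UNIV\<^esub> diag_map a' b' = diag_map (a * a') (b * b')"
  using assms by (simp add: BijGroup_UNIV_mult diag_map_Bij diag_map_comp)

lemma BijGroup_one_eq_diag_map: "\<one>\<^bsub>BijGroup UNIV\<^esub> = diag_map 1 1"
  by (auto simp: BijGroup_def fun_eq_iff)

locale cubic_extension =
  fixes q :: nat and \<iota> :: "'f::{field,finite} \<Rightarrow> 'e::{field,finite}" and \<alpha> :: 'e
  assumes card_f: "CARD('f) = q" and card_e: "CARD('e) = q ^ 3" and emb: "field_embedding \<iota>"
    and q_mod_4: "q mod 4 = 1" and q_mod_3: "q mod 3 \<noteq> 1"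
    and prim: "primitive_element \<alpha>"
begin

text \<open>This is both the index of the nonzero elements of \<open>F\<close> in those of
  \<open>E\<close> and the number of points of a projective plane of order \<open>q\<close>.\<close>

definition s :: nat where "s = q ^ 2 + q + 1"
abbreviation \<mu> :: 'e where "\<mu> \<equiv> \<alpha> ^ (q - 1)"
abbreviation \<omega> :: 'e where "\<omega> \<equiv> \<alpha> ^ s"

section \<open>Powers of the primitive element and the factorization of the nonzero elements of
  \<open>E\<close>\<close>

lemma q_gt_1: "1 < q"
proof -
  have "card {0, 1 :: 'f} \<le> CARD('f)" by (rule card_mono) auto
  then show ?thesis by (simp add: card_f)
qed

lemma s_pos: "0 < s"
  by (simp add: s_def)

lemma q_cube: "q ^ 3 - 1 = (q - 1) * s"
proof -
  \<comment> \<open>Writing \<open>q\<close> as a successor removes the truncated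
    subtraction.\<close>
  obtain r where r: "q = Suc r" using q_gt_1 by (metis gr0_conv_Suc less_trans zero_less_one)
  show ?thesis unfolding s_def unfolding r by (simp add: power3_eq_cube power2_eq_square algebra_simps)
qed

lemma \<alpha>_neq_0: "\<alpha> \<noteq> 0"
  using prim by (simp add: primitive_element_def)

lemma \<alpha>_order: "\<alpha> ^ ((q - 1) * s) = 1"
  using finite_field_power_card_minus_1[OF \<alpha>_neq_0] by (simp only: card_e q_cube)

lemma \<alpha>_power_mod: "\<alpha> ^ (n mod ((q - 1) * s)) = \<alpha> ^ n"
  by (rule power_mod_exponent[OF \<alpha>_order])

text \<open>The powers with exponents in this range exhaust the \<open>q ^ 3 - 1\<close> nonzero
  elements, and there are exactly that many exponents.\<close>

lemma \<alpha>_power_inj: "inj_on (\<lambda>n. \<alpha> ^ n) {..<(q - 1) * s}"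
proof (rule eq_card_imp_inj_on)
  have N: "0 < (q - 1) * s" using q_gt_1 s_pos by simp
  have "(\<lambda>n. \<alpha> ^ n) ` {..<(q - 1) * s} = UNIV - {0}"
  proof (intro subset_antisym subsetI)
    fix x :: 'e assume "x \<in> UNIV - {0}"
    then obtain n where "x = \<alpha> ^ n" using prim unfolding primitive_element_def by auto
    then have "x = \<alpha> ^ (n mod ((q - 1) * s))" by (simp only: \<alpha>_power_mod)
    then show "x \<in> (\<lambda>n. \<alpha> ^ n) ` {..<(q - 1) * s}" using N by (intro image_eqI) auto
  qed (use \<alpha>_neq_0 in auto)
  then show "card ((\<lambda>n. \<alpha> ^ n) ` {..<(q - 1) * s}) = card {..<(q - 1) * s}"
    using q_cube by (simp add: card_Diff_subset card_e)
qed simp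

lemma \<alpha>_power_eq_1_iff: "\<alpha> ^ n = 1 \<longleftrightarrow> (q - 1) * s dvd n"
proof
  assume "\<alpha> ^ n = 1"
  then have "\<alpha> ^ (n mod ((q - 1) * s)) = \<alpha> ^ 0" by (simp only: \<alpha>_power_mod power_0)
  moreover have "0 < (q - 1) * s" using q_gt_1 s_pos by simp
  ultimately have "n mod ((q - 1) * s) = 0"
    using inj_onD[OF \<alpha>_power_inj, of "n mod ((q - 1) * s)" 0] by auto
  then show "(q - 1) * s dvd n" by blast
next
  assume "(q - 1) * s dvd n"
  then show "\<alpha> ^ n = 1" using power_mult_exponent_eq_1[OF \<alpha>_order] by (auto elim!: dvdE)
qed

lemma \<iota>_power: "a \<noteq> 0 \<Longrightarrow> \<iota> a ^ (q - 1) = 1"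
  using finite_field_power_card_minus_1[of a] field_embedding_power[OF emb, of a "q - 1"] emb
  unfolding card_f field_embedding_def by simp

lemma \<iota>_power_q: "\<iota> a ^ q = \<iota> a"
  using finite_field_power_card[of a] field_embedding_power[OF emb, of a q] unfolding card_f by simp

lemma \<omega>_power: "\<omega> ^ (q - 1) = 1"
  unfolding power_mult[symmetric] using \<alpha>_order by (simp add: mult.commute)

lemma \<mu>_power: "\<mu> ^ s = 1"
  unfolding power_mult[symmetric] by (rule \<alpha>_order)

text \<open>A nonzero element of \<open>F\<close> has \<open>(q - 1)\<close>-th power 1, so its
  exponent over \<open>\<alpha>\<close> is a multiple of \<open>s\<close>. Equality follows by
  counting, as the right side has at most \<open>q - 1\<close> elements.\<close>

lemma range_\<iota>: "\<iota> ` (UNIV - {0}) = (\<lambda>t. \<omega> ^ t) ` {..<q - 1}"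
proof (rule card_subset_eq)
  show "\<iota> ` (UNIV - {0}) \<subseteq> (\<lambda>t. \<omega> ^ t) ` {..<q - 1}"
  proof
    fix x assume "x \<in> \<iota> ` (UNIV - {0})"
    then obtain a where a: "a \<noteq> 0" "x = \<iota> a" by blast
    then have "x \<noteq> 0" using field_embedding_eq_0_iff[OF emb] by simp
    then obtain n where n: "x = \<alpha> ^ n" using prim unfolding primitive_element_def by auto
    have "\<alpha> ^ (n * (q - 1)) = 1" using \<iota>_power[OF a(1)] n a by (simp add: power_mult)
    then have "(q - 1) * s dvd (q - 1) * n" unfolding \<alpha>_power_eq_1_iff by (simp add: mult.commute)
    then obtain t where t: "n = s * t" using q_gt_1 by auto
    have "x = \<omega> ^ t" unfolding n t by (rule power_mult)
    also have "\<dots> = \<omega> ^ (t mod (q - 1))"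
      by (rule power_mod_exponent[OF \<omega>_power, symmetric])
    finally show "x \<in> (\<lambda>t. \<omega> ^ t) ` {..<q - 1}"
      using q_gt_1 by (intro image_eqI) auto
  qed
  have c: "card (\<iota> ` (UNIV - {0})) = q - 1"
    using card_image[OF inj_on_subset[OF field_embedding_inj[OF emb]], of "UNIV - {0}"]
    by (simp add: card_Diff_subset card_f)
  have "card ((\<lambda>t. \<omega> ^ t) ` {..<q - 1}) \<le> q - 1"
    using card_image_le[of "{..<q - 1}"] by simp
  moreover have "card (\<iota> ` (UNIV - {0})) \<le> card ((\<lambda>t. \<omega> ^ t) ` {..<q - 1})"
    using \<open>\<iota> ` (UNIV - {0}) \<subseteq> _\<close> by (intro card_mono) auto
  ultimately show "card (\<iota> ` (UNIV - {0})) = card ((\<lambda>t. \<omega> ^ t) ` {..<q - 1})"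
    using c by simp
qed simp

lemma \<omega>_power_in_range:
  obtains a where "a \<noteq> 0" "\<omega> ^ t = \<iota> a"
proof -
  have "\<omega> ^ t = \<omega> ^ (t mod (q - 1))"
    by (rule power_mod_exponent[OF \<omega>_power, symmetric])
  also have "\<dots> \<in> \<iota> ` (UNIV - {0})"
    unfolding range_\<iota> using q_gt_1 by (intro imageI) simp
  finally show ?thesis using that by blast
qed

text \<open>Modulo \<open>q - 1\<close> the number \<open>s\<close> is 3, so the gcd divides 3. This
  is where the hypothesis on \<open>q mod 3\<close> enters.\<close>

lemma coprime_q_s: "coprime (q - 1) s"
proof -
  obtain r where r: "q = Suc r" using q_gt_1 by (metis gr0_conv_Suc less_trans zero_less_one)
  have "s = 3 + r * (r + 3)" unfolding s_def unfolding r by (simp add: power2_eq_square algebra_simps)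
  then have "gcd (q - 1) s = gcd r 3"
    unfolding r by (metis add.commute diff_Suc_1 gcd_add_mult mult.commute)
  moreover have "\<not> 3 dvd r" using q_mod_3 unfolding r by presburger
  then have "coprime r 3"
    using prime_imp_coprime[of 3 r] by (simp add: coprime_commute)
  ultimately show ?thesis by (simp add: coprime_iff_gcd_eq_1)
qed

text \<open>Raising to the power \<open>q - 1\<close> shows that \<open>s\<close> divides
  \<open>i * (q - 1)\<close>, hence \<open>i\<close> by coprimality. So distinct powers of
  \<open>\<mu>\<close> are never proportional over \<open>F\<close>.\<close>

lemma \<mu>_power_in_range:
  assumes "\<mu> ^ i = \<iota> a"
  shows "\<mu> ^ i = 1"
proof -
  have "a \<noteq> 0" using assms \<alpha>_neq_0 field_embedding_eq_0_iff[OF emb] by (metis power_not_zero)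
  then have "\<alpha> ^ ((q - 1) * (i * (q - 1))) = 1"
    using \<iota>_power[of a] assms by (simp add: power_mult)
  then have "s dvd i * (q - 1)" unfolding \<alpha>_power_eq_1_iff using q_gt_1 s_pos by simp
  then have "s dvd i" using coprime_q_s by (metis coprime_commute coprime_dvd_mult_left_iff)
  then show ?thesis using power_mult_exponent_eq_1[OF \<mu>_power] by (auto elim!: dvdE)
qed

text \<open>A Bezout relation between \<open>s\<close> and \<open>q - 1\<close> writes
  \<open>\<alpha>\<close> as a power of \<open>\<omega>\<close> times a power of
  \<open>\<mu>\<close>, and powers of \<open>\<omega>\<close> lie in \<open>F\<close>.\<close>

lemma factor_range_\<iota>_power_\<mu>:
  assumes "x \<noteq> 0"
  obtains i a where "a \<noteq> 0" "x = \<iota> a * \<mu> ^ i"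
proof -
  obtain n where n: "x = \<alpha> ^ n" using prim assms unfolding primitive_element_def by auto
  obtain k y where ky: "s * k = (q - 1) * y + 1"
    using bezout_nat[of s "q - 1"] coprime_q_s s_pos by (auto simp: coprime_iff_gcd_eq_1 gcd.commute)
  \<comment> \<open>To stay within the natural numbers, the exponent \<open>-(q - 1) * y\<close> is
    replaced by \<open>(q - 1) * y * (s - 1)\<close>, which agrees with it modulo
    \<open>(q - 1) * s\<close>. Here \<open>m\<close> stands for \<open>q - 1\<close>.\<close>
  have "m * y + 1 + m * (y * (s - 1)) = 1 + m * s * y" for m
    using s_pos by (cases s) (simp_all add: algebra_simps)
  then have "s * k + (q - 1) * (y * (s - 1)) = 1 + (q - 1) * s * y"
    unfolding ky by blast
  then have "\<alpha> ^ (s * k + (q - 1) * (y * (s - 1))) = \<alpha>"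
    by (simp only: power_add power_mult[of _ "(q - 1) * s"] \<alpha>_order power_one) simp
  then have "\<alpha> = \<omega> ^ k * \<mu> ^ (y * (s - 1))"
    by (simp only: power_add power_mult)
  then have "x = \<omega> ^ (k * n) * \<mu> ^ (y * (s - 1) * n)"
    unfolding n by (metis power_mult power_mult_distrib)
  then show ?thesis using \<omega>_power_in_range[of "k * n"] that by metis
qed

section \<open>The elements of the group and its order\<close>

definition G_elem :: "nat \<Rightarrow> nat \<Rightarrow> 'e \<times> 'e \<Rightarrow> 'e \<times> 'e" where
  "G_elem i j = diag_map (\<mu> ^ i) (inverse (\<mu> ^ i) * \<omega> ^ (4 * j))"

lemma \<mu>_power_mod: "\<mu> ^ (i mod s) = \<mu> ^ i"
  by (rule power_mod_exponent[OF \<mu>_power])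

text \<open>Here the hypothesis on \<open>q mod 4\<close> enters: the division in the order of the
  group and in the orbit sizes is exact.\<close>

lemma four_dvd: "4 * ((q - 1) div 4) = q - 1"
  using q_mod_4 by presburger

lemma \<omega>4_power_mod: "\<omega> ^ (4 * (j mod ((q - 1) div 4))) = \<omega> ^ (4 * j)"
proof -
  have 1: "(\<omega> ^ 4) ^ ((q - 1) div 4) = 1"
    unfolding power_mult[symmetric, of \<omega> 4] four_dvd by (rule \<omega>_power)
  show ?thesis
    unfolding power_mult[of \<omega> 4]
    by (rule power_mod_exponent[OF 1])
qed

lemma G_elem_mult: "G_elem i j \<otimes>\<^bsub>BijGroup UNIV\<^esub> G_elem i' j' = G_elem (i + i') (j + j')"
  using \<alpha>_neq_0 unfolding G_elem_def by (subst diag_map_mult) (simp_all add: power_add algebra_simps)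

lemma c_map_eq: "c_map q \<alpha> = G_elem 1 0"
  by (auto simp: c_map_def G_elem_def fun_eq_iff Let_def)

lemma z_map_eq: "z_map q \<alpha> = G_elem 0 1"
  by (auto simp: z_map_def s_def G_elem_def fun_eq_iff Let_def)

lemma G_elem_Bij: "G_elem i j \<in> Bij UNIV"
  unfolding G_elem_def by (rule diag_map_Bij) (use \<alpha>_neq_0 in auto)

lemma G_elem_0: "G_elem 0 0 = \<one>\<^bsub>BijGroup UNIV\<^esub>"
  by (simp add: G_elem_def BijGroup_one_eq_diag_map)

lemma G_elem_inv: "\<exists>i' j'. inv\<^bsub>BijGroup UNIV\<^esub> (G_elem i j) = G_elem i' j'"
proof -
  \<comment> \<open>The inverse is written with nonnegative exponents, using that
    \<open>\<mu> ^ s\<close> and \<open>\<omega> ^ (q - 1)\<close> are 1.\<close>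
  have "G_elem (i * (s - 1)) (j * (q - 2)) \<otimes>\<^bsub>BijGroup UNIV\<^esub> G_elem i j = G_elem (i * s) (j * (q - 1))"
  proof -
    have "s = Suc (s - 1)" "q - 1 = Suc (q - 2)"
      using s_pos q_gt_1 by simp_all
    then have "i * (s - 1) + i = i * s" "j * (q - 2) + j = j * (q - 1)"
      by (metis add.commute mult_Suc_right)+
    then show ?thesis by (simp add: G_elem_mult)
  qed
  also have "\<dots> = \<one>\<^bsub>BijGroup UNIV\<^esub>"
  proof -
    have "\<mu> ^ (i * s) = 1" using power_mult_exponent_eq_1[OF \<mu>_power] by (simp only: mult.commute)
    moreover have "\<omega> ^ (4 * (j * (q - 1))) = 1" using power_mult_exponent_eq_1[OF \<omega>_power, of "4 * j"] by (simp only: mult_ac)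
    ultimately show ?thesis unfolding G_elem_def BijGroup_one_eq_diag_map by simp
  qed
  finally show ?thesis
    using group.inv_equality[OF group_BijGroup] G_elem_Bij
    by (metis BijGroup_def partial_object.select_convs(1))
qed

text \<open>\<open>G_elem i j\<close> is the normal form \<open>c^i z^j\<close>. It covers the whole
  group because exponents add under multiplication and inverses are again of this form.\<close>

lemma generate_eq: "generate (BijGroup UNIV) {c_map q \<alpha>, z_map q \<alpha>} = {G_elem i j | i j. True}"
proof (intro subset_antisym subsetI)
  fix g assume "g \<in> generate (BijGroup UNIV) {c_map q \<alpha>, z_map q \<alpha>}"
  then show "g \<in> {G_elem i j | i j. True}"
  proof induction
    case one
    show ?case using G_elem_0[symmetric] by blast
  next
    case (incl h)
    then show ?case using c_map_eq z_map_eq by blast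
  next
    case (inv h)
    then obtain i j where "h = G_elem i j" using c_map_eq z_map_eq by blast
    then show ?case using G_elem_inv by simp
  next
    case (eng h1 h2)
    then obtain i j i' j' where "h1 = G_elem i j" "h2 = G_elem i' j'" by blast
    then show ?case using G_elem_mult by blast
  qed
next
  fix g assume "g \<in> {G_elem i j | i j. True}"
  then obtain i j where g: "g = G_elem i j" by blast
  have c: "G_elem 1 0 \<in> generate (BijGroup UNIV) {c_map q \<alpha>, z_map q \<alpha>}"
    and z: "G_elem 0 1 \<in> generate (BijGroup UNIV) {c_map q \<alpha>, z_map q \<alpha>}"
    using generate.incl[of _ "{c_map q \<alpha>, z_map q \<alpha>}" "BijGroup UNIV"] c_map_eq z_map_eq by simp_all
  have i: "G_elem i 0 \<in> generate (BijGroup UNIV) {c_map q \<alpha>, z_map q \<alpha>}" for i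
  proof (induction i)
    case 0
    then show ?case using generate.one G_elem_0 by metis
  next
    case (Suc i)
    then show ?case using generate.eng[OF c Suc] by (simp add: G_elem_mult)
  qed
  have j: "G_elem 0 j \<in> generate (BijGroup UNIV) {c_map q \<alpha>, z_map q \<alpha>}" for j
  proof (induction j)
    case 0
    then show ?case using generate.one G_elem_0 by metis
  next
    case (Suc j)
    then show ?case using generate.eng[OF z Suc] by (simp add: G_elem_mult)
  qed
  show "g \<in> generate (BijGroup UNIV) {c_map q \<alpha>, z_map q \<alpha>}"
    using generate.eng[OF i[of i] j[of j]] by (simp add: g G_elem_mult)
qed

lemma carrier_G: "carrier (G_group q \<alpha>) = {G_elem i j | i j. True}"
  by (simp add: G_group_def generate_eq)

lemma G_elem_in_carrier: "G_elem i j \<in> carrier (G_group q \<alpha>)"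
  using carrier_G by blast

lemma group_G: "group (G_group q \<alpha>)"
  unfolding G_group_def
proof (rule group.subgroup_imp_group[OF group_BijGroup group.generate_is_subgroup[OF group_BijGroup]])
  show "{c_map q \<alpha>, z_map q \<alpha>} \<subseteq> carrier (BijGroup UNIV)"
    using G_elem_Bij c_map_eq z_map_eq by (simp add: BijGroup_def)
qed

lemma one_G: "\<one>\<^bsub>G_group q \<alpha>\<^esub> = G_elem 0 0"
  by (simp add: G_group_def G_elem_0)

text \<open>Reduced pairs of exponents index the group. They give distinct elements because all the
  exponents of \<open>\<alpha>\<close> involved stay below its order
  \<open>(q - 1) * s\<close>.\<close>

lemma order_G: "order (G_group q \<alpha>) = (q - 1) div 4 * s"
proof -
  let ?A = "{..<s} \<times> {..<(q - 1) div 4}"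
  have m: "0 < (q - 1) div 4" using four_dvd q_gt_1 by (metis gr0I mult_0_right not_less_eq zero_less_diff less_irrefl)
  have "inj_on (\<lambda>(i, j). G_elem i j) ?A"
  proof (rule inj_onI, clarify)
    fix i j i' j' assume i: "i < s" "i' < s" and j: "j < (q - 1) div 4" "j' < (q - 1) div 4"
      and eq: "G_elem i j = G_elem i' j'"
    have \<mu>: "\<alpha> ^ ((q - 1) * i) = \<alpha> ^ ((q - 1) * i')" and \<omega>: "\<alpha> ^ (s * (4 * j)) = \<alpha> ^ (s * (4 * j'))"
      using eq \<alpha>_neq_0 unfolding G_elem_def diag_map_eq_iff power_mult by auto
    have "(q - 1) * i < (q - 1) * s" "(q - 1) * i' < (q - 1) * s"
      using i q_gt_1 by simp_all
    then have "(q - 1) * i = (q - 1) * i'"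
      using inj_onD[OF \<alpha>_power_inj \<mu>] by simp
    moreover have "4 * j < q - 1" "4 * j' < q - 1" using j four_dvd by auto
    then have "s * (4 * j) < (q - 1) * s" "s * (4 * j') < (q - 1) * s"
      using s_pos by (simp_all add: mult.commute[of s])
    then have "s * (4 * j) = s * (4 * j')"
      using inj_onD[OF \<alpha>_power_inj \<omega>] by simp
    ultimately show "i = i' \<and> j = j'" using q_gt_1 s_pos by simp
  qed
  moreover have "(\<lambda>(i, j). G_elem i j) ` ?A = carrier (G_group q \<alpha>)"
  proof (intro subset_antisym subsetI)
    fix g assume "g \<in> carrier (G_group q \<alpha>)"
    then obtain i j where g: "g = G_elem i j" using carrier_G by blast
    also have "\<dots> = G_elem (i mod s) (j mod ((q - 1) div 4))"
      unfolding G_elem_def \<mu>_power_mod \<omega>4_power_mod ..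
    finally show "g \<in> (\<lambda>(i, j). G_elem i j) ` ?A" using m s_pos by (intro image_eqI[of _ _ "(i mod s, j mod ((q - 1) div 4))"]) auto
  qed (auto simp: carrier_G)
  ultimately have "card (carrier (G_group q \<alpha>)) = card ?A" by (metis card_image)
  then show ?thesis by (simp add: order_def)
qed

end

section \<open>The quadric and the Klein correspondence\<close>

sublocale cubic_extension \<subseteq> V: vector_space "scaleV \<iota>"
  by (rule vector_space_scaleV[OF emb])

context cubic_extension
begin

section \<open>The trace form, its polarization and the points of the quadric\<close>

lemma trace3_add: "trace3 q (x + y :: 'e) = trace3 q x + trace3 q y"
proof -
  have add: "(u + v :: 'e) ^ q = u ^ q + v ^ q" for u v
    using power_card_add[OF emb, of u v] by (simp only: card_f)
  show ?thesis
    by (simp add: trace3_def power2_eq_square power_mult add)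
qed

lemma trace3_scale: "trace3 q (\<iota> a * x) = \<iota> a * trace3 q x"
  by (simp add: trace3_def power_mult_distrib power2_eq_square power_mult \<iota>_power_q algebra_simps)

lemma trace3_0: "trace3 q (0 :: 'e) = 0"
  using q_gt_1 by (simp add: trace3_def zero_power)

definition polar :: "'e \<times> 'e \<Rightarrow> 'e \<times> 'e \<Rightarrow> 'e" where
  "polar w w' = trace3 q (fst w * snd w' + fst w' * snd w)"

lemma Qform_scale: "Qform q (scaleV \<iota> k w) = \<iota> k * (\<iota> k * Qform q w)"
  by (simp add: Qform_def scaleV_def flip: trace3_scale) (simp add: mult_ac)

lemma Qform_add: "Qform q (w + w') = Qform q w + Qform q w' + polar w w'"
  by (simp add: Qform_def polar_def flip: trace3_add) (simp add: algebra_simps)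

lemma polar_scale: "polar (scaleV \<iota> k w) (scaleV \<iota> l w') = \<iota> k * (\<iota> l * polar w w')"
  by (simp add: polar_def scaleV_def flip: trace3_scale) (simp add: algebra_simps)

lemma polar_self: "polar w w = Qform q w + Qform q w"
  by (simp add: Qform_def polar_def mult.commute flip: trace3_add)

abbreviation pt :: "'e \<times> 'e \<Rightarrow> ('e \<times> 'e) set" where
  "pt w \<equiv> V.span {w}"

lemma mem_pt_iff: "w' \<in> pt w \<longleftrightarrow> (\<exists>k. w' = scaleV \<iota> k w)"
  unfolding V.span_singleton by auto

lemma pt_self: "w \<in> pt w"
  by (rule V.span_base) simp

lemma pt_scale:
  assumes "k \<noteq> 0"
  shows "pt (scaleV \<iota> k w) = pt w"
proof (rule subset_antisym)
  show "pt (scaleV \<iota> k w) \<subseteq> pt w"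
    using mem_pt_iff by (intro V.span_minimal) auto
  have "w = scaleV \<iota> (inverse k) (scaleV \<iota> k w)" using assms by simp
  then have "w \<in> pt (scaleV \<iota> k w)" using mem_pt_iff by blast
  then show "pt w \<subseteq> pt (scaleV \<iota> k w)" by (intro V.span_minimal) auto
qed

lemma quadric_points_iff:
  "x \<in> quadric_points q \<iota> \<longleftrightarrow> (\<exists>w. w \<noteq> 0 \<and> x = pt w \<and> Qform q w = 0)"
proof
  assume "x \<in> quadric_points q \<iota>"
  then have "x \<in> subspaces_of_dim (scaleV \<iota>) 1" "\<forall>w\<in>x. Qform q w = 0"
    unfolding quadric_points_def by blast+
  then show "\<exists>w. w \<noteq> 0 \<and> x = pt w \<and> Qform q w = 0"
    using V.subspaces_of_dim_1_iff[of x] pt_self by blast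
next
  assume "\<exists>w. w \<noteq> 0 \<and> x = pt w \<and> Qform q w = 0"
  then obtain w where w: "w \<noteq> 0" "x = pt w" "Qform q w = 0" by blast
  then have "x \<in> subspaces_of_dim (scaleV \<iota>) 1" using V.subspaces_of_dim_1_iff by blast
  moreover have "\<forall>w\<in>x. Qform q w = 0" 
  proof
    fix v assume "v \<in> x"
    then obtain k where "v = scaleV \<iota> k w" unfolding w(2) mem_pt_iff by blast
    then show "Qform q v = 0" using w(3) by (simp add: Qform_scale)
  qed
  ultimately show "x \<in> quadric_points q \<iota>" unfolding quadric_points_def by blast
qed

text \<open>The quadric line contains \<open>w + w'\<close>, so in \<open>Qform_add\<close> only the
  polar term is left.\<close>

lemma collinear_imp_polar:
  assumes "collinear_on_quadric q \<iota> (pt w) (pt w')"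
  shows "polar w w' = 0"
proof -
  obtain l where l: "l \<in> quadric_lines q \<iota>" "pt w \<subseteq> l" "pt w' \<subseteq> l"
    using assms unfolding collinear_on_quadric_def by blast
  then have sub: "V.subspace l" and Q: "\<And>v. v \<in> l \<Longrightarrow> Qform q v = 0"
    unfolding quadric_lines_def subspaces_of_dim_def by blast+
  have "w \<in> l" "w' \<in> l" using l pt_self by blast+
  then show ?thesis
    using Q[of w] Q[of w'] Q[OF V.subspace_add[OF sub], of w w'] by (simp add: Qform_add)
qed

text \<open>On the span of \<open>w\<close> and \<open>w'\<close> the quadratic form reduces to a
  multiple of the mixed term \<open>polar w w'\<close>.\<close>

lemma polar_imp_collinear:
  assumes "w \<noteq> 0" "w' \<notin> pt w" "Qform q w = 0" "Qform q w' = 0" "polar w w' = 0"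
  shows "collinear_on_quadric q \<iota> (pt w) (pt w')"
proof -
  have "Qform q v = 0" if v: "v \<in> V.span {w', w}" for v
  proof -
    obtain k where "v - scaleV \<iota> k w' \<in> pt w"
      using v unfolding V.span_insert[of w' "{w}"] by blast
    then obtain m where "v - scaleV \<iota> k w' = scaleV \<iota> m w" unfolding mem_pt_iff by blast
    then have "v = scaleV \<iota> m w + scaleV \<iota> k w'" by (simp add: diff_eq_eq)
    then show ?thesis using assms by (simp add: Qform_add Qform_scale polar_scale)
  qed
  then have "V.span {w', w} \<in> quadric_lines q \<iota>"
    unfolding quadric_lines_def using V.span_pair_in_subspaces_of_dim[OF assms(1,2)] by blast
  moreover have "pt w \<subseteq> V.span {w', w}" "pt w' \<subseteq> V.span {w', w}"
    by (rule V.span_mono; simp)+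
  ultimately show ?thesis unfolding collinear_on_quadric_def by blast
qed

section \<open>Diagonal similarities of the quadratic form\<close>

definition similarity :: "('e \<times> 'e \<Rightarrow> 'e \<times> 'e) \<Rightarrow> bool" where
  "similarity g \<longleftrightarrow> (\<exists>a b t. a \<noteq> 0 \<and> b \<noteq> 0 \<and> a * b = \<iota> t \<and> g = diag_map a b)"

lemma similarity_G_elem: "similarity (G_elem i j)"
proof -
  obtain t where t: "\<omega> ^ (4 * j) = \<iota> t" using \<omega>_power_in_range by metis
  have "\<mu> ^ i * (inverse (\<mu> ^ i) * \<omega> ^ (4 * j)) = \<iota> t"
    using \<alpha>_neq_0 t by simp
  then show ?thesis
    unfolding similarity_def G_elem_def using \<alpha>_neq_0 by (intro exI conjI) (auto simp del: power_mult)
qed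

lemma similarity_comp:
  assumes "similarity g" "similarity h"
  shows "similarity (g \<circ> h)"
proof -
  obtain a b t where g: "a \<noteq> 0" "b \<noteq> 0" "a * b = \<iota> t" "g = diag_map a b"
    using assms unfolding similarity_def by blast
  obtain a' b' t' where h: "a' \<noteq> 0" "b' \<noteq> 0" "a' * b' = \<iota> t'" "h = diag_map a' b'"
    using assms unfolding similarity_def by blast
  have "(a * a') * (b * b') = \<iota> t * \<iota> t'" using g h by (metis mult.assoc mult.left_commute)
  also have "\<dots> = \<iota> (t * t')" using emb unfolding field_embedding_def by simp
  finally have "(a * a') * (b * b') = \<iota> (t * t')" .
  moreover have "a * a' \<noteq> 0" "b * b' \<noteq> 0" using g h by simp_all
  ultimately show ?thesis
    unfolding similarity_def g(4) h(4) diag_map_comp by blast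
qed

context
  fixes g
  assumes g: "similarity g"
begin

lemma similarity_bij: "bij g"
  using g diag_map_bij unfolding similarity_def by blast

lemma similarity_scale: "g (scaleV \<iota> k w) = scaleV \<iota> k (g w)"
  using g unfolding similarity_def by (cases w) (auto simp: scaleV_def)

lemma similarity_eq_0_iff: "g w = 0 \<longleftrightarrow> w = 0"
  using g unfolding similarity_def by (cases w) (auto simp: zero_prod_def)

lemma similarity_fst_eq_0_iff: "fst (g w) = 0 \<longleftrightarrow> fst w = 0"
  using g unfolding similarity_def by (cases w) auto

lemma similarity_snd_eq_0_iff: "snd (g w) = 0 \<longleftrightarrow> snd w = 0"
  using g unfolding similarity_def by (cases w) auto

text \<open>Both forms pick up the factor \<open>a * b\<close> inside the trace; it lies in
  \<open>F\<close>, so it can be taken out by \<open>F\<close>-linearity.\<close>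

lemma similarity_polar:
  obtains t where "t \<noteq> 0" "\<And>w w'. polar (g w) (g w') = \<iota> t * polar w w'"
    "\<And>w. Qform q (g w) = \<iota> t * Qform q w"
proof -
  obtain a b t where g': "a \<noteq> 0" "b \<noteq> 0" "a * b = \<iota> t" "g = diag_map a b"
    using g unfolding similarity_def by blast
  have "\<iota> t \<noteq> 0" using g' by (metis mult_eq_0_iff)
  then have "t \<noteq> 0" using field_embedding_eq_0_iff[OF emb] by simp
  moreover have "polar (g w) (g w') = \<iota> t * polar w w'" for w w'
  proof -
    have "polar (g w) (g w') = trace3 q ((a * b) * (fst w * snd w' + fst w' * snd w))"
      unfolding g'(4) polar_def by (cases w; cases w') (simp add: algebra_simps)
    then show ?thesis unfolding g'(3) trace3_scale polar_def .
  qed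
  moreover have "Qform q (g w) = \<iota> t * Qform q w" for w
  proof -
    have "Qform q (g w) = trace3 q ((a * b) * (fst w * snd w))"
      unfolding g'(4) Qform_def by (cases w) (simp add: algebra_simps)
    then show ?thesis unfolding g'(3) trace3_scale Qform_def .
  qed
  ultimately show ?thesis using that by blast
qed

lemma similarity_polar_eq_0_iff: "polar (g w) (g w') = 0 \<longleftrightarrow> polar w w' = 0"
  using similarity_polar field_embedding_eq_0_iff[OF emb] by (metis mult_eq_0_iff)

lemma similarity_Qform_eq_0_iff: "Qform q (g w) = 0 \<longleftrightarrow> Qform q w = 0"
  using similarity_polar field_embedding_eq_0_iff[OF emb] by (metis mult_eq_0_iff)

lemma similarity_pt: "g ` pt w = pt (g w)"
  unfolding V.span_singleton by (simp add: image_image similarity_scale)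

lemma similarity_quadric: "bij_betw (image g) (quadric_points q \<iota>) (quadric_points q \<iota>)"
  unfolding bij_betw_def
proof
  show "inj_on (image g) (quadric_points q \<iota>)"
    using similarity_bij by (meson bij_is_inj inj_image_eq_iff inj_onI)
  show "image g ` quadric_points q \<iota> = quadric_points q \<iota>"
  proof (intro subset_antisym subsetI)
    fix y assume "y \<in> image g ` quadric_points q \<iota>"
    then obtain x where x: "x \<in> quadric_points q \<iota>" "y = g ` x" by (rule imageE)
    obtain w where w: "w \<noteq> 0" "x = pt w" "Qform q w = 0"
      using x(1) unfolding quadric_points_iff by blast
    show "y \<in> quadric_points q \<iota>"
      unfolding quadric_points_iff
      by (rule exI[of _ "g w"])
        (use x w similarity_eq_0_iff similarity_Qform_eq_0_iff similarity_pt in simp)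
  next
    fix y assume "y \<in> quadric_points q \<iota>"
    then obtain w where w: "w \<noteq> 0" "y = pt w" "Qform q w = 0" unfolding quadric_points_iff by blast
    obtain v where v: "w = g v" using similarity_bij by (metis bij_pointE)
    have "pt v \<in> quadric_points q \<iota>"
      unfolding quadric_points_iff
      by (rule exI[of _ v]) (use w v similarity_eq_0_iff similarity_Qform_eq_0_iff in simp)
    moreover have "y = g ` pt v" using w v similarity_pt by simp
    ultimately show "y \<in> image g ` quadric_points q \<iota>" by blast
  qed
qed

end

end

locale klein_setup = cubic_extension +
  fixes \<kappa> :: "('b \<times> 'b) set \<Rightarrow> ('a ^ 4) set" and p \<pi> :: "('a ^ 4) set"
  assumes klein: "klein_correspondence q \<iota> \<kappa>"
    and p_point: "p \<in> pg3_points" and pi1: "\<kappa> ` pi1 \<iota> = {L \<in> pg3_lines. p \<subseteq> L}"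
    and \<pi>_plane: "\<pi> \<in> pg3_planes" and pi2: "\<kappa> ` pi2 \<iota> = {L \<in> pg3_lines. L \<subseteq> \<pi>}"
begin

abbreviation QP :: "('b \<times> 'b) set set" where "QP \<equiv> quadric_points q \<iota>"
abbreviation KA where "KA \<equiv> klein_action q \<iota> \<kappa>"

section \<open>Translating incidence of lines into conditions on vectors\<close>

lemma \<kappa>_bij: "bij_betw \<kappa> QP pg3_lines"
  using klein unfolding klein_correspondence_def by blast

lemma \<kappa>_line: "x \<in> QP \<Longrightarrow> \<kappa> x \<in> pg3_lines"
  using \<kappa>_bij by (rule bij_betwE[THEN bspec])

lemma line_\<kappa>E:
  assumes "L \<in> pg3_lines"
  obtains w where "w \<noteq> 0" "Qform q w = 0" "pt w \<in> QP" "L = \<kappa> (pt w)"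
proof -
  obtain x where x: "x \<in> QP" "L = \<kappa> x"
    using \<kappa>_bij assms by (metis bij_betw_imp_surj_on image_iff)
  moreover obtain w where "w \<noteq> 0" "x = pt w" "Qform q w = 0"
    using x unfolding quadric_points_iff by blast
  ultimately show ?thesis using that by blast
qed

lemma \<kappa>_eq_iff: "x \<in> QP \<Longrightarrow> y \<in> QP \<Longrightarrow> \<kappa> x = \<kappa> y \<longleftrightarrow> x = y"
  using \<kappa>_bij by (metis bij_betw_imp_inj_on inj_on_eq_iff)

lemma pt_QP: "w \<noteq> 0 \<Longrightarrow> Qform q w = 0 \<Longrightarrow> pt w \<in> QP"
  unfolding quadric_points_iff by blast

text \<open>For distinct points this is the defining property of the Klein correspondence. Equal
  points are treated apart, since \<open>w\<close> and \<open>w'\<close> then span no line of the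
  quadric; there both sides hold, as \<open>polar w w\<close> is twice
  \<open>Qform q w\<close>.\<close>

lemma meet_iff_polar:
  assumes "w \<noteq> 0" "Qform q w = 0" "w' \<noteq> 0" "Qform q w' = 0"
  shows "lines_meet (\<kappa> (pt w)) (\<kappa> (pt w')) \<longleftrightarrow> polar w w' = 0"
proof (cases "w' \<in> pt w")
  case True
  then obtain k where k: "w' = scaleV \<iota> k w" unfolding mem_pt_iff by blast
  have "k \<noteq> 0" using k assms(3) V.scale_zero_left by metis
  then have eq: "pt w' = pt w" unfolding k by (rule pt_scale)
  obtain P where "P \<in> pg3_points" "P \<subseteq> \<kappa> (pt w)"
  proof -
    have l: "\<kappa> (pt w) \<in> pg3_lines" using \<kappa>_line pt_QP assms by blast
    show ?thesis
      by (rule common_point[of "\<kappa> (pt w)" "\<kappa> (pt w)" "\<kappa> (pt w)"])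
        (use pg3_subspace[OF l] pg3_dim[OF l] that in auto)
  qed
  then have "lines_meet (\<kappa> (pt w)) (\<kappa> (pt w'))" unfolding eq lines_meet_iff by blast
  moreover have "polar w w' = 0"
    using polar_scale[of 1 w k w] assms(2) unfolding k by (simp add: polar_self)
  ultimately show ?thesis by blast
next
  case False
  have "collinear_on_quadric q \<iota> (pt w) (pt w') \<longleftrightarrow> polar w w' = 0"
    using collinear_imp_polar polar_imp_collinear[OF assms(1) False assms(2,4)] by blast
  moreover have "pt w \<in> QP" "pt w' \<in> QP" using assms pt_QP by blast+
  ultimately show ?thesis using klein unfolding klein_correspondence_def by blast
qed

lemma p_subset_iff:
  assumes "w \<noteq> 0" "Qform q w = 0"
  shows "p \<subseteq> \<kappa> (pt w) \<longleftrightarrow> snd w = 0"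
proof
  assume "snd w = 0"
  then have "w = (fst w, 0)" by (simp add: prod_eq_iff)
  moreover have "fst w \<noteq> 0" using \<open>snd w = 0\<close> assms(1) by (auto simp: prod_eq_iff)
  ultimately have "pt w \<in> pi1 \<iota>" unfolding pi1_def by (metis (mono_tags, lifting) mem_Collect_eq)
  then have "\<kappa> (pt w) \<in> star p" using pi1 by blast
  then show "p \<subseteq> \<kappa> (pt w)" by simp
next
  assume "p \<subseteq> \<kappa> (pt w)"
  then have "\<kappa> (pt w) \<in> \<kappa> ` pi1 \<iota>"
    unfolding pi1 using \<kappa>_line[OF pt_QP[OF assms]] by simp
  then obtain u where u: "u \<noteq> 0" "\<kappa> (pt w) = \<kappa> (pt (u, 0))" unfolding pi1_def by blast
  have "pt (u, 0) \<in> QP"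
    using u by (intro pt_QP) (simp_all add: zero_prod_def Qform_def trace3_0)
  then have "pt w = pt (u, 0)" using u pt_QP[OF assms] \<kappa>_eq_iff by simp
  then have "w \<in> pt (u, 0)" using pt_self by blast
  then show "snd w = 0" unfolding mem_pt_iff by (auto simp: scaleV_def)
qed

lemma subset_\<pi>_iff:
  assumes "w \<noteq> 0" "Qform q w = 0"
  shows "\<kappa> (pt w) \<subseteq> \<pi> \<longleftrightarrow> fst w = 0"
proof
  assume "fst w = 0"
  then have "w = (0, snd w)" by (simp add: prod_eq_iff)
  moreover have "snd w \<noteq> 0" using \<open>fst w = 0\<close> assms(1) by (auto simp: prod_eq_iff)
  ultimately have "pt w \<in> pi2 \<iota>" unfolding pi2_def by (metis (mono_tags, lifting) mem_Collect_eq)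
  then have "\<kappa> (pt w) \<in> {L \<in> pg3_lines. L \<subseteq> \<pi>}" using pi2 by blast
  then show "\<kappa> (pt w) \<subseteq> \<pi>" by simp
next
  assume "\<kappa> (pt w) \<subseteq> \<pi>"
  then have "\<kappa> (pt w) \<in> \<kappa> ` pi2 \<iota>"
    unfolding pi2 using \<kappa>_line[OF pt_QP[OF assms]] by simp
  then obtain v where v: "v \<noteq> 0" "\<kappa> (pt w) = \<kappa> (pt (0, v))" unfolding pi2_def by blast
  have "pt (0, v) \<in> QP"
    using v by (intro pt_QP) (simp_all add: zero_prod_def Qform_def trace3_0)
  then have "pt w = pt (0, v)" using v pt_QP[OF assms] \<kappa>_eq_iff by simp
  then have "w \<in> pt (0, v)" using pt_self by blast
  then show "fst w = 0" unfolding mem_pt_iff by (auto simp: scaleV_def)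
qed

text \<open>A line of \<open>\<pi>\<close> through \<open>p\<close> would come from a vector with
  both coordinates zero: the two generators are disjoint.\<close>

lemma p_notin_\<pi>: "\<not> p \<subseteq> \<pi>"
proof
  assume "p \<subseteq> \<pi>"
  then obtain L M where L: "L \<in> star p" "L \<subseteq> \<pi>" by (rule two_lines_in_plane[OF p_point \<pi>_plane])
  then have "L \<in> pg3_lines" by simp
  then obtain w where w: "w \<noteq> 0" "Qform q w = 0" "pt w \<in> QP" "L = \<kappa> (pt w)" by (rule line_\<kappa>E)
  then have "snd w = 0" "fst w = 0"
    using L p_subset_iff[OF w(1,2)] subset_\<pi>_iff[OF w(1,2)] by simp_all
  then show False using w(1) by (simp add: prod_eq_iff)
qed

section \<open>The collineations induced by similarities\<close>

definition line_map :: "('b \<times> 'b \<Rightarrow> 'b \<times> 'b) \<Rightarrow> ('a ^ 4) set \<Rightarrow> ('a ^ 4) set" where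
  "line_map g L = \<kappa> (g ` inv_into QP \<kappa> L)"

lemma line_map_\<kappa>: "x \<in> QP \<Longrightarrow> line_map g (\<kappa> x) = \<kappa> (g ` x)"
  unfolding line_map_def using \<kappa>_bij by (simp add: bij_betw_inv_into_left)

text \<open>In terms of vectors, meeting is orthogonality and passing through \<open>p\<close> is
  the vanishing of the second coordinate. A diagonal similarity preserves both.\<close>

lemma line_permutation_line_map:
  assumes g: "similarity g"
  shows "line_permutation (line_map g) p"
proof
  have "bij_betw (\<kappa> \<circ> (image g \<circ> inv_into QP \<kappa>)) pg3_lines pg3_lines"
    using bij_betw_trans[OF bij_betw_trans[OF bij_betw_inv_into[OF \<kappa>_bij] similarity_quadric[OF g]] \<kappa>_bij] .
  then show "bij_betw (line_map g) pg3_lines pg3_lines"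
    by (simp add: line_map_def comp_def cong: bij_betw_cong)
  show "p \<in> pg3_points" by (rule p_point)
  fix L :: "('a ^ 4) set" assume "L \<in> pg3_lines"
  then obtain w where w: "w \<noteq> 0" "Qform q w = 0" "pt w \<in> QP" "L = \<kappa> (pt w)" by (rule line_\<kappa>E)
  have gw: "g w \<noteq> 0" "Qform q (g w) = 0"
    using w similarity_eq_0_iff[OF g] similarity_Qform_eq_0_iff[OF g] by simp_all
  have L: "line_map g L = \<kappa> (pt (g w))" using w line_map_\<kappa> similarity_pt[OF g] by simp
  show "p \<subseteq> line_map g L \<longleftrightarrow> p \<subseteq> L"
    unfolding L unfolding w(4) p_subset_iff[OF w(1,2)] p_subset_iff[OF gw]
    by (rule similarity_snd_eq_0_iff[OF g])
  fix M :: "('a ^ 4) set" assume "M \<in> pg3_lines"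
  then obtain v where v: "v \<noteq> 0" "Qform q v = 0" "pt v \<in> QP" "M = \<kappa> (pt v)" by (rule line_\<kappa>E)
  have gv: "g v \<noteq> 0" "Qform q (g v) = 0"
    using v similarity_eq_0_iff[OF g] similarity_Qform_eq_0_iff[OF g] by simp_all
  have M: "line_map g M = \<kappa> (pt (g v))" using v line_map_\<kappa> similarity_pt[OF g] by simp
  show "lines_meet (line_map g L) (line_map g M) \<longleftrightarrow> lines_meet L M"
    unfolding L M unfolding w(4) v(4) meet_iff_polar[OF w(1,2) v(1,2)] meet_iff_polar[OF gw gv]
    by (rule similarity_polar_eq_0_iff[OF g])
qed

text \<open>Resolves the definite description: existence and uniqueness both come from
  \<open>line_permutation\<close>.\<close>

lemma klein_action_eq_induced:
  assumes "similarity g"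
  shows "KA g = line_permutation.induced (line_map g)"
proof -
  interpret line_permutation "line_map g" p by (rule line_permutation_line_map[OF assms])
  show ?thesis unfolding klein_action_def
  proof (rule the_equality)
    show "induced \<in> collineations \<and> (\<forall>x\<in>QP. induced ` points_on (\<kappa> x) = points_on (\<kappa> (g ` x)))"
      using induced_collineation induced_points_on[OF \<kappa>_line] by (simp add: line_map_\<kappa>)
    fix f assume f: "f \<in> collineations \<and> (\<forall>x\<in>QP. f ` points_on (\<kappa> x) = points_on (\<kappa> (g ` x)))"
    show "f = induced"
    proof (rule collineation_eq_induced)
      show "f \<in> collineations" using f by blast
      fix L :: "('a ^ 4) set" assume "L \<in> pg3_lines"
      then obtain w where "pt w \<in> QP" "L = \<kappa> (pt w)" by (rule line_\<kappa>E)
      then show "f ` points_on L = points_on (line_map g L)" using f by (simp add: line_map_\<kappa>)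
    qed
  qed
qed

lemma KA_Bij: "similarity g \<Longrightarrow> KA g \<in> Bij pg3_points"
  unfolding klein_action_eq_induced
  by (rule line_permutation.induced_Bij[OF line_permutation_line_map])

lemma KA_point: "similarity g \<Longrightarrow> P \<in> pg3_points \<Longrightarrow> KA g P \<in> pg3_points"
  using KA_Bij Bij_imp_funcset by blast

lemma KA_subset_iff:
  assumes "similarity g" "P \<in> pg3_points" "w \<noteq> 0" "Qform q w = 0"
  shows "KA g P \<subseteq> \<kappa> (pt (g w)) \<longleftrightarrow> P \<subseteq> \<kappa> (pt w)"
  using line_permutation.induced_subset_iff[OF line_permutation_line_map[OF assms(1)] assms(2)
      \<kappa>_line[OF pt_QP[OF assms(3,4)]]]
  unfolding klein_action_eq_induced[OF assms(1)] line_map_\<kappa>[OF pt_QP[OF assms(3,4)]] similarity_pt[OF assms(1)] .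

text \<open>The means of computing images of points: a candidate only has to lie on the image of
  each line through \<open>P\<close>.\<close>

lemma KA_unique:
  assumes "similarity g" "P \<in> pg3_points" "Q \<in> pg3_points"
    and "\<And>w. w \<noteq> 0 \<Longrightarrow> Qform q w = 0 \<Longrightarrow> P \<subseteq> \<kappa> (pt w) \<Longrightarrow> Q \<subseteq> \<kappa> (pt (g w))"
  shows "KA g P = Q"
proof -
  interpret line_permutation "line_map g" p by (rule line_permutation_line_map[OF assms(1)])
  have "Q = induced P"
  proof (rule corresponds_unique[OF assms(3) corresponds_induced[OF assms(2)]])
    fix L assume L: "L \<in> star P"
    then have "L \<in> pg3_lines" by simp
    then obtain w where w: "w \<noteq> 0" "Qform q w = 0" "pt w \<in> QP" "L = \<kappa> (pt w)" by (rule line_\<kappa>E)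
    then show "Q \<subseteq> line_map g L"
      using assms(4)[OF w(1,2)] L by (simp add: line_map_\<kappa> similarity_pt[OF assms(1)])
  qed
  then show ?thesis using klein_action_eq_induced[OF assms(1)] by simp
qed

lemma KA_comp:
  assumes "similarity g" "similarity h" "P \<in> pg3_points"
  shows "KA (g \<circ> h) P = KA g (KA h P)"
proof (rule KA_unique[OF similarity_comp[OF assms(1,2)] assms(3)])
  show "KA g (KA h P) \<in> pg3_points" using KA_point assms by blast
  fix w :: "'b \<times> 'b" assume w: "w \<noteq> 0" "Qform q w = 0" "P \<subseteq> \<kappa> (pt w)"
  then have hw: "h w \<noteq> 0" "Qform q (h w) = 0"
    using similarity_eq_0_iff[OF assms(2)] similarity_Qform_eq_0_iff[OF assms(2)] by simp_all
  have "KA h P \<subseteq> \<kappa> (pt (h w))" using KA_subset_iff[OF assms(2,3) w(1,2)] w(3) by simp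
  then have "KA g (KA h P) \<subseteq> \<kappa> (pt (g (h w)))"
    using KA_subset_iff[OF assms(1) KA_point[OF assms(2,3)] hw] by simp
  then show "KA g (KA h P) \<subseteq> \<kappa> (pt ((g \<circ> h) w))" by simp
qed

lemma similarity_carrier: "g \<in> carrier (G_group q \<alpha>) \<Longrightarrow> similarity g"
  unfolding carrier_G using similarity_G_elem by blast

lemma group_action_KA: "group_action (G_group q \<alpha>) pg3_points KA"
proof -
  have "KA \<in> hom (G_group q \<alpha>) (BijGroup pg3_points)"
  proof (rule homI)
    fix g assume "g \<in> carrier (G_group q \<alpha>)"
    then show "KA g \<in> carrier (BijGroup pg3_points)"
      using KA_Bij similarity_carrier by (simp add: BijGroup_def)
  next
    fix g h assume gh: "g \<in> carrier (G_group q \<alpha>)" "h \<in> carrier (G_group q \<alpha>)"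
    then have sim: "similarity g" "similarity h" using similarity_carrier by blast+
    have "g \<in> Bij UNIV" "h \<in> Bij UNIV" using gh carrier_G G_elem_Bij by auto
    then have "g \<otimes>\<^bsub>G_group q \<alpha>\<^esub> h = g \<circ> h"
      unfolding G_group_def by (simp add: BijGroup_UNIV_mult)
    moreover have "KA (g \<circ> h) = compose pg3_points (KA g) (KA h)"
    proof (rule extensionalityI[where A = pg3_points])
      show "KA (g \<circ> h) \<in> extensional pg3_points"
        using KA_Bij[OF similarity_comp[OF sim]] Bij_imp_extensional by blast
      show "compose pg3_points (KA g) (KA h) \<in> extensional pg3_points" by simp
      fix P :: "('a ^ 4) set" assume "P \<in> pg3_points"
      then show "KA (g \<circ> h) P = compose pg3_points (KA g) (KA h) P"
        using KA_comp[OF sim] by (simp add: compose_eq)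
    qed
    moreover have "KA g \<in> Bij pg3_points" "KA h \<in> Bij pg3_points" using KA_Bij sim by blast+
    ultimately show "KA (g \<otimes>\<^bsub>G_group q \<alpha>\<^esub> h) = KA g \<otimes>\<^bsub>BijGroup pg3_points\<^esub> KA h"
      by (simp add: BijGroup_def)
  qed
  then show ?thesis
    unfolding group_action_def group_hom_def group_hom_axioms_def
    using group_G group_BijGroup by blast
qed

section \<open>Fixed point, invariant plane, transitivity and freeness\<close>

lemma KA_p:
  assumes "similarity g"
  shows "KA g p = p"
proof (rule KA_unique[OF assms p_point p_point])
  fix w :: "'b \<times> 'b" assume w: "w \<noteq> 0" "Qform q w = 0" "p \<subseteq> \<kappa> (pt w)"
  have "g w \<noteq> 0" "Qform q (g w) = 0"
    using w similarity_eq_0_iff[OF assms] similarity_Qform_eq_0_iff[OF assms] by simp_all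
  then show "p \<subseteq> \<kappa> (pt (g w))"
    using w p_subset_iff similarity_snd_eq_0_iff[OF assms] by simp
qed

text \<open>\<open>P\<close> lies on some line of \<open>\<pi>\<close>, and such lines are mapped to
  lines of \<open>\<pi>\<close> because a zero first coordinate stays zero.\<close>

lemma KA_\<pi>:
  assumes "similarity g" "P \<in> pg3_points" "P \<subseteq> \<pi>"
  shows "KA g P \<subseteq> \<pi>"
proof -
  obtain L M where L: "L \<in> star P" "L \<subseteq> \<pi>" by (rule two_lines_in_plane[OF assms(2) \<pi>_plane assms(3)])
  then have "L \<in> pg3_lines" by simp
  then obtain w where w: "w \<noteq> 0" "Qform q w = 0" "pt w \<in> QP" "L = \<kappa> (pt w)" by (rule line_\<kappa>E)
  have gw: "g w \<noteq> 0" "Qform q (g w) = 0"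
    using w similarity_eq_0_iff[OF assms(1)] similarity_Qform_eq_0_iff[OF assms(1)] by simp_all
  have "KA g P \<subseteq> \<kappa> (pt (g w))"
    using KA_subset_iff[OF assms(1,2) w(1,2)] L w by simp
  also have "\<dots> \<subseteq> \<pi>"
    using subset_\<pi>_iff[OF gw] subset_\<pi>_iff[OF w(1,2)] similarity_fst_eq_0_iff[OF assms(1)] L w by simp
  finally show ?thesis .
qed

lemma line_through_p:
  assumes "P \<in> pg3_points" "P \<noteq> p"
  obtains u where "u \<noteq> 0" "P \<subseteq> \<kappa> (pt (u, 0))" "Qform q (u, 0) = 0"
proof -
  obtain L where L: "L \<in> star P" "L \<in> star p" using join_exists[OF assms(1) p_point assms(2)] .
  then have "L \<in> pg3_lines" by simp
  then obtain w where w: "w \<noteq> 0" "Qform q w = 0" "pt w \<in> QP" "L = \<kappa> (pt w)" by (rule line_\<kappa>E)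
  have "snd w = 0" using p_subset_iff[OF w(1,2)] L w by simp
  then have "w = (fst w, 0)" by (simp add: prod_eq_iff)
  moreover have "fst w \<noteq> 0" using \<open>snd w = 0\<close> w(1) by (auto simp: prod_eq_iff)
  moreover have "P \<subseteq> \<kappa> (pt w)" using L w by simp
  ultimately show ?thesis using that[of "fst w"] w(2) by metis
qed

text \<open>Points of \<open>\<pi>\<close> are located by their lines to \<open>p\<close>, that is,
  by first coordinates up to factors from \<open>F\<close>. Powers of \<open>c\<close> multiply
  these coordinates by powers of \<open>\<mu>\<close>, which reach every class.\<close>

lemma transitive_on_\<pi>:
  assumes "P \<in> pg3_points" "P \<subseteq> \<pi>" "P' \<in> pg3_points" "P' \<subseteq> \<pi>"
  shows "\<exists>g\<in>carrier (G_group q \<alpha>). KA g P = P'"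
proof -
  have "P \<noteq> p" "P' \<noteq> p" using assms p_notin_\<pi> by blast+
  then obtain u u' where u: "u \<noteq> 0" "P \<subseteq> \<kappa> (pt (u, 0))" "Qform q (u, 0) = 0"
    and u': "u' \<noteq> 0" "P' \<subseteq> \<kappa> (pt (u', 0))" "Qform q (u', 0) = 0"
    using line_through_p assms by metis
  have "u' / u \<noteq> 0" using u u' by simp
  then obtain i a where a: "a \<noteq> 0" "u' / u = \<iota> a * \<mu> ^ i" by (rule factor_range_\<iota>_power_\<mu>)
  define g where "g = G_elem i 0"
  have sim: "similarity g" unfolding g_def by (rule similarity_G_elem)
  have "u' = \<iota> a * (\<mu> ^ i * u)" using a u by (simp add: field_simps)
  then have "(u', 0) = scaleV \<iota> a (g (u, 0))" unfolding g_def G_elem_def by (simp add: scaleV_def)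
  then have "pt (u', 0) = pt (g (u, 0))"
    using pt_scale[OF a(1)] by simp
  then have KL: "KA g P \<subseteq> \<kappa> (pt (u', 0))"
    using KA_subset_iff[OF sim assms(1) _ u(3)] u by (simp add: zero_prod_def)
  have K\<pi>: "KA g P \<subseteq> \<pi>" by (rule KA_\<pi>[OF sim assms(1,2)])
  have Kp: "KA g P \<in> pg3_points" by (rule KA_point[OF sim assms(1)])
  have w0: "(u', 0) \<noteq> (0 :: 'b \<times> 'b)" using u' by (simp add: zero_prod_def)
  \<comment> \<open>Both points lie in \<open>\<pi>\<close> and on the same line through
    \<open>p\<close>. If they differed, this line would be contained in
    \<open>\<pi>\<close>.\<close>
  have "KA g P = P'"
  proof (rule ccontr)
    assume "KA g P \<noteq> P'"
    then have "\<kappa> (pt (u', 0)) = vec.span (KA g P \<union> P')"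
      using line_eq_join[OF Kp assms(3) _ \<kappa>_line[OF pt_QP[OF w0 u'(3)]] KL u'(2)] by simp
    also have "\<dots> \<subseteq> \<pi>"
      using K\<pi> assms(4) pg3_subspace[OF \<pi>_plane] by (intro vec.span_minimal) simp_all
    finally have "fst (u', 0 :: 'b) = 0" using subset_\<pi>_iff[OF w0 u'(3)] by blast
    then show False using u' by simp
  qed
  then show ?thesis using G_elem_in_carrier g_def by blast
qed

text \<open>If \<open>(u, v)\<close> and \<open>(u, t v)\<close> with \<open>t \<noteq> 1\<close> correspond to lines through \<open>P\<close>, then \<open>(0, v)\<close> is
  orthogonal to everything orthogonal to both, so it corresponds to a line through \<open>P\<close> as well.\<close>

lemma homology_fixes_imp_in_\<pi>:
  assumes t: "t \<noteq> 1" "t \<noteq> 0" and g: "g = diag_map 1 (\<iota> t)" and P: "P \<in> pg3_points" "P \<noteq> p" and fix_P: "KA g P = P"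
  shows "P \<subseteq> \<pi>"
proof -
  have sim: "similarity g" unfolding similarity_def g
    using t field_embedding_eq_0_iff[OF emb] by (intro exI[of _ 1] exI[of _ "\<iota> t"] exI[of _ t]) simp
  \<comment> \<open>Such a line has a vector whose second coordinate is nonzero, so that
    \<open>(0, v)\<close> below represents a point of the quadric.\<close>
  have "\<exists>L. L \<in> star P \<and> \<not> p \<subseteq> L"
  proof (rule ccontr)
    assume "\<nexists>L. L \<in> star P \<and> \<not> p \<subseteq> L"
    then have "star P \<subseteq> star p" by auto
    then show False using star_subset_imp_eq[OF P(1) p_point] P(2) by blast
  qed
  then obtain L where L: "L \<in> star P" "\<not> p \<subseteq> L" by blast
  then have "L \<in> pg3_lines" by simp
  then obtain w where w: "w \<noteq> 0" "Qform q w = 0" "pt w \<in> QP" "L = \<kappa> (pt w)" by (rule line_\<kappa>E)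
  obtain u v where uv: "w = (u, v)" by (cases w)
  have "v \<noteq> 0" using L p_subset_iff[OF w(1,2)] w uv by simp
  then have v0: "(0, v) \<noteq> (0 :: 'b \<times> 'b)" by (simp add: zero_prod_def)
  have Qv: "Qform q (0, v) = 0" by (simp add: Qform_def trace3_0)
  have gw: "g w \<noteq> 0" "Qform q (g w) = 0"
    using w similarity_eq_0_iff[OF sim] similarity_Qform_eq_0_iff[OF sim] by simp_all
  have Pgw: "P \<subseteq> \<kappa> (pt (g w))" using KA_subset_iff[OF sim P(1) w(1,2)] fix_P L w by simp
  have line: "\<kappa> (pt (0, v)) \<in> pg3_lines" using \<kappa>_line pt_QP v0 Qv by blast
  have "P \<subseteq> \<kappa> (pt (0, v))"
  proof (rule line_meeting_star[OF P(1) line])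
    fix M assume M: "M \<in> star P"
    then have "M \<in> pg3_lines" by simp
    then obtain m where m: "m \<noteq> 0" "Qform q m = 0" "pt m \<in> QP" "M = \<kappa> (pt m)" by (rule line_\<kappa>E)
    have "lines_meet (\<kappa> (pt m)) (\<kappa> (pt w))" "lines_meet (\<kappa> (pt m)) (\<kappa> (pt (g w)))"
      unfolding lines_meet_iff using P(1) Pgw M L m w by auto
    then have 1: "polar m w = 0" and 2: "polar m (g w) = 0"
      using meet_iff_polar[OF m(1,2) w(1,2)] meet_iff_polar[OF m(1,2) gw] by simp_all
    \<comment> \<open>This is the decomposition \<open>g w = w + (t - 1) (0, v)\<close>, with
      \<open>t\<close> viewed in \<open>E\<close>, paired with \<open>m\<close>.\<close>
    have "polar m w + \<iota> (t - 1) * polar m (0, v) = polar m (g w)"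
      unfolding polar_def trace3_scale[symmetric] trace3_add[symmetric] uv g
      using emb by (simp add: field_embedding_diff[OF emb] field_embedding_def algebra_simps)
    then have "\<iota> (t - 1) * polar m (0, v) = 0" using 1 2 by simp
    then have "polar m (0, v) = 0" using t field_embedding_eq_0_iff[OF emb] by simp
    then show "lines_meet M (\<kappa> (pt (0, v)))"
      unfolding m(4) using meet_iff_polar[OF m(1,2) v0 Qv] by simp
  qed
  also have "\<dots> \<subseteq> \<pi>" using subset_\<pi>_iff[OF v0 Qv] by simp
  finally show ?thesis .
qed

lemma free_action:
  assumes "P \<in> pg3_points" "P \<noteq> p" "\<not> P \<subseteq> \<pi>" "g \<in> carrier (G_group q \<alpha>)" "KA g P = P"
  shows "g = \<one>\<^bsub>G_group q \<alpha>\<^esub>"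
proof -
  obtain i j where g: "g = G_elem i j" using assms carrier_G by blast
  have sim: "similarity g" unfolding g by (rule similarity_G_elem)
  obtain u where u: "u \<noteq> 0" "P \<subseteq> \<kappa> (pt (u, 0))" "Qform q (u, 0) = 0"
    using line_through_p assms by metis
  have w0: "(u, 0) \<noteq> (0 :: 'b \<times> 'b)" using u by (simp add: zero_prod_def)
  have gw: "g (u, 0) \<noteq> 0" "Qform q (g (u, 0)) = 0"
    using w0 u similarity_eq_0_iff[OF sim] similarity_Qform_eq_0_iff[OF sim] by simp_all
  have PL: "P \<subseteq> \<kappa> (pt (g (u, 0)))" using KA_subset_iff[OF sim assms(1) w0 u(3)] assms(5) u(2) by simp
  \<comment> \<open>The line of \<open>(u, 0)\<close> and its image both join \<open>P\<close> and
    \<open>p\<close>, so they coincide and \<open>(u, 0)\<close> is an eigenvector of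
    \<open>g\<close> with eigenvalue in \<open>F\<close>.\<close>
  have "p \<subseteq> \<kappa> (pt (u, 0))" "p \<subseteq> \<kappa> (pt (g (u, 0)))"
    using p_subset_iff[OF w0 u(3)] p_subset_iff[OF gw] similarity_snd_eq_0_iff[OF sim] by simp_all
  then have "\<kappa> (pt (u, 0)) = \<kappa> (pt (g (u, 0)))"
    using two_points_line_unique[OF assms(1) p_point assms(2), of "\<kappa> (pt (u, 0))" "\<kappa> (pt (g (u, 0)))"]
      u(2) PL \<kappa>_line[OF pt_QP[OF w0 u(3)]] \<kappa>_line[OF pt_QP[OF gw]] by simp
  then have "pt (u, 0) = pt (g (u, 0))"
    using \<kappa>_eq_iff pt_QP w0 u(3) gw by blast
  then have "g (u, 0) \<in> pt (u, 0)" using pt_self by blast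
  then obtain a where "\<mu> ^ i * u = \<iota> a * u"
    unfolding mem_pt_iff g G_elem_def by (auto simp: scaleV_def)
  then have "\<mu> ^ i = \<iota> a" using u by simp
  then have \<mu>1: "\<mu> ^ i = 1" by (rule \<mu>_power_in_range)
  obtain t where t: "t \<noteq> 0" "\<omega> ^ (4 * j) = \<iota> t" by (rule \<omega>_power_in_range)
  have g_eq: "g = diag_map 1 (\<iota> t)" unfolding g G_elem_def \<mu>1 t(2) by simp
  have "t = 1" using homology_fixes_imp_in_\<pi>[OF _ t(1) g_eq assms(1,2,5)] assms(3) by blast
  then have "g = diag_map 1 1" using g_eq emb unfolding field_embedding_def by simp
  then show ?thesis by (simp add: one_G G_elem_def)
qed

section \<open>Point counts and the orbit decomposition\<close>

lemma card_points_\<pi>: "card (points_on \<pi>) = q ^ 2 + q + 1"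
proof -
  have "card (points_on \<pi>) * (q - 1) = s * (q - 1)"
    using card_points_on[OF \<pi>_plane] q_cube by (simp add: card_f mult.commute)
  then have "card (points_on \<pi>) = s" using q_gt_1 by simp
  then show ?thesis by (simp only: s_def)
qed

lemma card_pg3_points: "card (pg3_points :: ('a ^ 4) set set) = q ^ 3 + q ^ 2 + q + 1"
proof -
  have "points_on UNIV = (pg3_points :: ('a ^ 4) set set)" unfolding points_on_def by simp
  then have "card (pg3_points :: ('a ^ 4) set set) * (q - 1) = q ^ 4 - 1"
    using card_points_on[OF UNIV_subspaces_of_dim_4, where 'k = 'a] by (simp only: card_f)
  also have "\<dots> = (q ^ 3 + q ^ 2 + q + 1) * (q - 1)"
  proof -
    obtain r where r: "q = Suc r" using q_gt_1 by (metis gr0_conv_Suc less_trans zero_less_one)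
    show ?thesis unfolding r by (simp add: numeral_eq_Suc algebra_simps)
  qed
  finally show ?thesis using q_gt_1 by (simp only: mult_cancel2) simp
qed

theorem orbits_on_points:
  "\<exists>Os. orbits (G_group q \<alpha>) pg3_points KA = {{p}, points_on \<pi>} \<union> Os \<and>
      \<Union>Os = pg3_points - ({p} \<union> points_on \<pi>) \<and>
      card Os = 4 \<and>
      (\<forall>X\<in>Os. card X = (q - 1) div 4 * (q ^ 2 + q + 1))"
proof -
  interpret group_action "G_group q \<alpha>" pg3_points KA by (rule group_action_KA)
  interpret G: group "G_group q \<alpha>" by (rule group_G)
  define Y where "Y = pg3_points - ({p} \<union> points_on \<pi>)"
  let ?orb = "orbit (G_group q \<alpha>) KA"
  have orb_p: "?orb p = {p}"
    unfolding orbit_def using KA_p similarity_carrier G.one_closed by blast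
  have orb_\<pi>: "?orb P = points_on \<pi>" if P: "P \<in> points_on \<pi>" for P
  proof -
    have P': "P \<in> pg3_points" "P \<subseteq> \<pi>" using P unfolding points_on_def by blast+
    show ?thesis
    proof (intro subset_antisym subsetI)
      fix R assume "R \<in> ?orb P"
      then obtain g where "g \<in> carrier (G_group q \<alpha>)" "R = KA g P" unfolding orbit_def by blast
      then show "R \<in> points_on \<pi>"
        unfolding points_on_def using KA_point KA_\<pi> P' similarity_carrier by simp
    next
      fix R assume "R \<in> points_on \<pi>"
      then have "R \<in> pg3_points" "R \<subseteq> \<pi>" unfolding points_on_def by simp_all
      then obtain g where "g \<in> carrier (G_group q \<alpha>)" "KA g P = R"
        using transitive_on_\<pi>[OF P'] by blast
      then show "R \<in> ?orb P" unfolding orbit_def by blast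
    qed
  qed
  have points: "pg3_points = insert p (points_on \<pi> \<union> Y)"
    unfolding Y_def points_on_def using p_point by auto
  have "0 < card (points_on \<pi>)" using card_points_\<pi> by simp
  \<comment> \<open>A point of \<open>\<pi>\<close> is needed for the image of
    \<open>points_on \<pi>\<close> under \<open>?orb\<close> to be a singleton rather than
    empty.\<close>
  then obtain P0 where P0: "P0 \<in> points_on \<pi>" by (metis card_gt_0_iff ex_in_conv)
  have orbits_eq: "orbits (G_group q \<alpha>) pg3_points KA = ?orb ` pg3_points"
    unfolding orbits_def by blast
  also have "\<dots> = {{p}, points_on \<pi>} \<union> ?orb ` Y"
  proof -
    have "?orb ` points_on \<pi> = {points_on \<pi>}" using orb_\<pi> P0 by (auto simp: image_iff)
    then show ?thesis unfolding points image_insert image_Un orb_p by simp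
  qed
  finally have orbs: "orbits (G_group q \<alpha>) pg3_points KA = {{p}, points_on \<pi>} \<union> ?orb ` Y" .
  have Y_point: "P \<in> pg3_points" "P \<noteq> p" "\<not> P \<subseteq> \<pi>" if "P \<in> Y" for P
    using that unfolding Y_def points_on_def by auto
  have mem: "P \<in> ?orb P" if "P \<in> pg3_points" for P using orbit_refl that .
  have orb_eq: "?orb P = ?orb R" if "P \<in> pg3_points" "R \<in> pg3_points" "S \<in> ?orb P" "S \<in> ?orb R" for P R S
    using disjoint_union[of "?orb P" "?orb R"] that orbits_eq by blast
  \<comment> \<open>If \<open>R\<close> in the orbit of \<open>P\<close> were \<open>p\<close> or a
    point of \<open>\<pi>\<close>, the orbit of \<open>R\<close>, which contains \<open>P\<close>,
    would be one of the two orbits already known.\<close>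
  have sub: "?orb P \<subseteq> Y" if P: "P \<in> Y" for P
  proof
    fix R assume R: "R \<in> ?orb P"
    then have Rp: "R \<in> pg3_points"
      unfolding orbit_def using KA_point similarity_carrier Y_point[OF P] by blast
    have eq: "?orb P = ?orb R" using orb_eq[OF Y_point(1)[OF P] Rp R mem[OF Rp]] .
    have PR: "P \<in> ?orb R" using mem[OF Y_point(1)[OF P]] eq by simp
    have "R \<noteq> p" using PR orb_p Y_point(2)[OF P] by auto
    moreover have "R \<notin> points_on \<pi>"
      using PR orb_\<pi> Y_point(3)[OF P] unfolding points_on_def by blast
    ultimately show "R \<in> Y" unfolding Y_def using Rp by blast
  qed
  have union: "\<Union> (?orb ` Y) = Y" using sub mem Y_point(1) by blast
  have card_orb: "card (?orb P) = (q - 1) div 4 * s" if P: "P \<in> Y" for P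
  proof -
    \<comment> \<open>Freeness makes the stabilizer trivial, so the orbit is as large as the
      group.\<close>
    have "stabilizer (G_group q \<alpha>) KA P \<subseteq> {\<one>\<^bsub>G_group q \<alpha>\<^esub>}"
      unfolding stabilizer_def using free_action Y_point[OF P] by blast
    moreover have "\<one>\<^bsub>G_group q \<alpha>\<^esub> \<in> stabilizer (G_group q \<alpha>) KA P"
      using stabilizer_one_closed[OF Y_point(1)[OF P]] .
    ultimately have "stabilizer (G_group q \<alpha>) KA P = {\<one>\<^bsub>G_group q \<alpha>\<^esub>}" by blast
    then show ?thesis
      using orbit_stabilizer_theorem[OF Y_point(1)[OF P]] order_G by simp
  qed
  have "card Y = card (pg3_points :: ('a ^ 4) set set) - card ({p} \<union> points_on \<pi>)"
    unfolding Y_def using p_point by (intro card_Diff_subset) (auto simp: points_on_def simp del: One_nat_def)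
  also have "card ({p} \<union> points_on \<pi>) = 1 + s"
  proof -
    have "p \<notin> points_on \<pi>" using p_notin_\<pi> unfolding points_on_def by blast
    then show ?thesis using card_points_\<pi> by (simp add: s_def)
  qed
  also have "card (pg3_points :: ('a ^ 4) set set) - (1 + s) = q ^ 3 - 1"
    unfolding card_pg3_points s_def by simp
  finally have cardY: "card Y = (q - 1) * s" using q_cube by simp
  \<comment> \<open>The orbits in \<open>Y\<close> are disjoint and of equal size, so their number
    is the quotient of \<open>(q - 1) * s\<close> by that size.\<close>
  have "(q - 1) div 4 * s * card (?orb ` Y) = card (\<Union> (?orb ` Y))"
  proof (rule card_partition)
    fix A B assume AB: "A \<in> ?orb ` Y" "B \<in> ?orb ` Y" "A \<noteq> B"
    then have "A \<in> orbits (G_group q \<alpha>) pg3_points KA" "B \<in> orbits (G_group q \<alpha>) pg3_points KA"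
      unfolding orbs by simp_all
    then show "A \<inter> B = {}" using disjoint_union[of A B] AB(3) by blast
  qed (use card_orb in auto)
  then have "(q - 1) div 4 * s * card (?orb ` Y) = (q - 1) * s" unfolding union cardY .
  also have "\<dots> = (q - 1) div 4 * s * 4" using four_dvd by (metis mult.assoc mult.commute)
  finally have "card (?orb ` Y) = 4"
    using s_pos four_dvd q_gt_1 by auto
  moreover have "\<forall>X\<in>?orb ` Y. card X = (q - 1) div 4 * (q ^ 2 + q + 1)"
    using card_orb unfolding s_def by blast
  ultimately show ?thesis using orbs union unfolding Y_def by blast
qed

end

theorem mainTheorem4:
  fixes q :: nat
    and \<iota> :: "'f::{field,finite} \<Rightarrow> 'e::{field,finite}"
    and \<alpha> :: 'e
    and \<kappa> :: "('e \<times> 'e) set \<Rightarrow> ('f ^ 4) set"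
    and p \<pi> :: "('f ^ 4) set"
  assumes "CARD('f) = q" and "CARD('e) = q ^ 3" and "field_embedding \<iota>"
    and "q mod 4 = 1" and "q mod 3 \<noteq> 1"
    and "primitive_element \<alpha>"
    and "klein_correspondence q \<iota> \<kappa>"
    and "p \<in> pg3_points" and "\<kappa> ` pi1 \<iota> = {L \<in> pg3_lines. p \<subseteq> L}"
    and "\<pi> \<in> pg3_planes" and "\<kappa> ` pi2 \<iota> = {L \<in> pg3_lines. L \<subseteq> \<pi>}"
  shows "card (points_on \<pi>) = q ^ 2 + q + 1 \<and>
    (\<exists>Os. orbits (G_group q \<alpha>) pg3_points (klein_action q \<iota> \<kappa>) = {{p}, points_on \<pi>} \<union> Os \<and>
      \<Union>Os = pg3_points - ({p} \<union> points_on \<pi>) \<and>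
      card Os = 4 \<and>
      (\<forall>X\<in>Os. card X = (q - 1) div 4 * (q ^ 2 + q + 1)))"
proof -
  interpret klein_setup q \<iota> \<alpha> \<kappa> p \<pi>
    by unfold_locales (fact assms)+
  show ?thesis using card_points_\<pi> orbits_on_points by blast
qed

end
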